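(* Let conditions (K1)--(K3) of the context hold and let the $m$-stage Runge--Kutta method with coefficients $(a_{ij})$, $(b_i)$ be algebraically stable and coercive (see context). Let $T>0$, $\tau>0$. For $0\le n\tau\le T$ let $u_n\in Y$ be the numerical solution of $$U_{ni}=u_n+\tau\sum_{j=1}^m a_{ij}\dot U_{nj},\quad \dot U_{ni}+A(U_{ni})U_{ni}=0\quad(i=1,\dots,m),\qquad u_{n+1}=u_n+\tau\sum_{i=1}^m b_i\dot U_{ni},$$ and suppose that $u_n^\star\in Y$ and $U_{ni}^\star\in Y$ solve these equations up to defects $d_{n+1}\in Y$ and $D_{ni}\in Y$ (with $SD_{ni},Sd_{n+1}\in Y$), for $0\le n\tau\le T$: $$U_{ni}^\star=u_n^\star+\tau\sum_{j=1}^m a_{ij}\dot U_{nj}^\star+D_{ni},\quad \dot U_{ni}^\star+A(U_{ni}^\star)U_{ni}^\star=0\quad(i=1,\dots,m),\qquad u_{n+1}^\star=u_n^\star+\tau\sum_{i=1}^m b_i\dot U_{ni}^\star+d_{n+1}.$$ Suppose that for $0\le n\tau\le T$ and for $i=1,\dots,m$, $$\|u_n^\star\|\le R,\quad \|U_{ni}^\star\|\le R\quad\text{and}\quad SU_{ni}^\star\in Y\ \text{ with }\ \|SU_{ni}^\star\|\le K.$$ Then there exist $\overline\tau>0$ and $\delta>0$, which depend only on $K$, $R$, $T$ and the coefficients of the Runge--Kutta method, such that for stepsizes $\tau\le\overline\tau$ and perturbations satisfying $$\|u_0-u_0^\star\|^2+\tau\sum_{0\le n\tau\le T}\Bigl(\sum_{i=1}^m\|SD_{ni}\|^2+\Bigl\|\frac{d_{n+1}}{\tau}\Bigr\|^2+\|Sd_{n+1}\|^2\Bigr)\le\delta^2,$$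 the error satisfies, for $0\le n\tau\le T$, $$\|u_n-u_n^\star\|^2\le C_Y\Bigl(\|u_0-u_0^\star\|^2+\tau\sum_{k=0}^{n-1}\Bigl(\sum_{i=1}^m\|SD_{ki}\|^2+\Bigl\|\frac{d_{k+1}}{\tau}\Bigr\|^2+\|Sd_{k+1}\|^2\Bigr)\Bigr),$$ $$|u_n-u_n^\star|^2\le C_X\Bigl(|u_0-u_0^\star|^2+\tau\sum_{k=0}^{n-1}\Bigl(\sum_{i=1}^m\|D_{ki}\|^2+\Bigl|\frac{d_{k+1}}{\tau}\Bigr|^2+\|d_{k+1}\|^2\Bigr)\Bigr),$$ where $C_Y$ depends only on $K$, $R$ and $T$, and $C_X$ depends only on $R$ and $T$.
   Context: Let $X$ and $Y$ be real Hilbert spaces such that $Y$ is densely and continuously embedded in $X$. The inner product on $X$ is $(\cdot,\cdot)$, the norms are $|\cdot|=\|\cdot\|_X$ and $\|\cdot\|=\|\cdot\|_Y$, chosen such that $|y|\le\|y\|$ for all $y\in Y$. For every $y\in Y$, $A(y)$ is a closed linear operator on $X$ with domain $D(A(y))$. For every $R>0$ the following conditions hold, with real numbers $M_R^A,M_R^B,L_R^A,L_R^B$ depending only on $R$. (K1) For every $y\in Y$, $A(y)$ has the open left complex half-plane in its resolvent set (in the sense of the complexification) and satisfies $(w,A(y)w)\ge0$ for all $w\in D(A(y))$. Moreover $Y\subset D(A(y))$, and for $\|y\|\le R$, $|A(y)w|\le M_R^A\|w\|$ for all $w\in Y$. (K2) There is an isometry $S:Y\to X$, self-adjoint as a linear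 operator on $X$ (with domain $Y$), such that for every $y\in Y$ with $\|y\|\le R$, $SA(y)S^{-1}=A(y)+B(y)$ (with equality of domains), where $|B(y)v|\le M_R^B|v|$ for all $v\in X$. (K3) For all $y,\widetilde y\in Y$ with $\|y\|\le R$, $\|\widetilde y\|\le R$: $|(A(y)-A(\widetilde y))w|\le L_R^A|y-\widetilde y|\,\|w\|$ for all $w\in Y$, and $|(B(y)-B(\widetilde y))v|\le L_R^B\|y-\widetilde y\|\,|v|$ for all $v\in X$. The evolution equation considered is $\dot u+A(u)u=0$ (no semilinear term). In the Runge--Kutta equations the dots on $U_{ni},U_{ni}^\star$ are only notation: $\dot U_{ni}=-A(U_{ni})U_{ni}$, etc. Coercivity: the matrix $\mathcal O=(a_{ij})\in\mathbb R^{m\times m}$ is invertible and there exist a positive diagonal matrix $\mathcal D=\mathrm{diag}(d_i)$ and $\alpha>0$ such that $v^T\mathcal D\mathcal O^{-1}v\ge\alpha\,v^T\mathcal Dv$ for all $v\in\mathbb R^m$. Algebraic stability: the weights $b_i$ are positive, and the matrix with entries $b_ia_{ij}+b_ja_{ji}-b_ib_j$ is positive semidefinite. Convention on the numerical solution: there is a constant $C_*$ depending only on the Runge--Kutta coefficients such that for every $\rho>0$ and $\|u_n\|\le\rho$ the equations for the stages have, for sufficiently small $\tau$ (depending on $\rho$), a unique solution $(U_{ni})\in Y^m$ with $|U_{ni}|\le C_*|u_n|$ and $\|U_{ni}\|\le C_*\|u_n\|$. Such a $C_*$ is fixed, and the numerical solution is the one with these stages. The data $X,Y,A,S$ and the Runge--Kutta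 method are fixed; constants said to depend only on $R$ (or $K,R,T$) may depend on the constants in (K1)--(K3) and the method, but not on $\tau$, $n$, or the sequences considered. *)

theory Defs
  imports "HOL-Analysis.Analysis"
begin

text \<open>
  The embedding of \<open>Y\<close> into \<open>X\<close> is an explicit map \<open>\<iota> :: 'y \<Rightarrow> 'x\<close>, so that for \<open>y :: 'y\<close> the
  norm \<open>\<parallel>y\<parallel>\<close> of \<open>Y\<close> is \<open>norm y\<close> and the norm \<open>|y|\<close> of \<open>X\<close> is \<open>norm (\<iota> y)\<close>.
\<close>

definition dense_embedding ::
    "('y::{real_inner,complete_space} \<Rightarrow> 'x::{real_inner,complete_space}) \<Rightarrow> bool" where
  "dense_embedding \<iota> \<longleftrightarrow> linear \<iota> \<and> inj \<iota> \<and> closure (range \<iota>) = UNIV \<and> (\<forall>y. norm (\<iota> y) \<le> norm y)"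

text \<open>The norm of \<open>Y\<close> on those elements of \<open>X\<close> that lie in \<open>Y\<close>; only meaningful on \<open>range \<iota>\<close>.\<close>

definition normY :: "('y::real_normed_vector \<Rightarrow> 'x) \<Rightarrow> 'x \<Rightarrow> real" where
  "normY \<iota> x = norm (inv \<iota> x)"

section \<open>Unbounded operators\<close>

text \<open>
  An operator on \<open>X\<close> is given by a domain \<open>Dom\<close> and a function \<open>f\<close> whose values off \<open>Dom\<close> are
  irrelevant. Its graph is a linear subspace iff \<open>Dom\<close> is one and \<open>f\<close> is linear on \<open>Dom\<close>.
\<close>

definition op_graph :: "'x set \<Rightarrow> ('x \<Rightarrow> 'x) \<Rightarrow> ('x \<times> 'x) set" where
  "op_graph Dom f = (\<lambda>x. (x, f x)) ` Dom"

definition closed_linear_operator :: "'x::real_normed_vector set \<Rightarrow> ('x \<Rightarrow> 'x) \<Rightarrow> bool" where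
  "closed_linear_operator Dom f \<longleftrightarrow> subspace (op_graph Dom f) \<and> closed (op_graph Dom f)"

definition adjoint_graph :: "('x::real_inner \<times> 'x) set \<Rightarrow> ('x \<times> 'x) set" where
  "adjoint_graph G = {(v, w). \<forall>(x, z)\<in>G. inner z v = inner x w}"

definition self_adjoint_graph :: "('x::real_inner \<times> 'x) set \<Rightarrow> bool" where
  "self_adjoint_graph G \<longleftrightarrow> closure (Domain G) = UNIV \<and> adjoint_graph G = G"

text \<open>
  The complexification of \<open>X\<close> is \<open>X \<times> X\<close> with the product Hilbert norm, \<open>(v, w)\<close> standing for
  \<open>v + i w\<close>. The map below is \<open>\<lambda> - f\<close>, where \<open>f\<close> acts componentwise on \<open>Dom \<times> Dom\<close>.
\<close>

definition complexified_shift :: "('x::real_vector \<Rightarrow> 'x) \<Rightarrow> complex \<Rightarrow> 'x \<times> 'x \<Rightarrow> 'x \<times> 'x" where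
  "complexified_shift f z = (\<lambda>(v, w).
     (Re z *\<^sub>R v - Im z *\<^sub>R w - f v, Im z *\<^sub>R v + Re z *\<^sub>R w - f w))"

definition resolvent_set :: "'x::real_normed_vector set \<Rightarrow> ('x \<Rightarrow> 'x) \<Rightarrow> complex set" where
  "resolvent_set Dom f = {z. bij_betw (complexified_shift f z) (Dom \<times> Dom) UNIV \<and>
     bounded_linear (inv_into (Dom \<times> Dom) (complexified_shift f z))}"

section \<open>The framework\<close>

definition K1 ::
    "('y::real_inner \<Rightarrow> 'x::real_inner) \<Rightarrow> ('y \<Rightarrow> 'x set) \<Rightarrow> ('y \<Rightarrow> 'x \<Rightarrow> 'x) \<Rightarrow> (real \<Rightarrow> real) \<Rightarrow> bool" where
  "K1 \<iota> DA A MA \<longleftrightarrow>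
     (\<forall>y. {z. Re z < 0} \<subseteq> resolvent_set (DA y) (A y) \<and>
          (\<forall>w\<in>DA y. 0 \<le> inner w (A y w)) \<and> range \<iota> \<subseteq> DA y) \<and>
     (\<forall>R>0. \<forall>y w. norm y \<le> R \<longrightarrow> norm (A y (\<iota> w)) \<le> MA R * norm w)"

text \<open>
  As an operator on \<open>X\<close> with domain \<open>Y\<close>, \<open>S\<close> has the graph \<open>{(\<iota> y, S y)}\<close>. That \<open>S\<close> is onto
  follows from its being isometric and self-adjoint. The last clause but one is the operator
  identity \<open>S A(y) S\<inverse> = A(y) + B(y)\<close>, domains included, as an equality of graphs: \<open>S w\<close> is in the
  domain of the left-hand side iff \<open>w \<in> D(A(y))\<close> and \<open>A(y) w \<in> Y\<close>.
\<close>

definition K2 ::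
    "('y::real_inner \<Rightarrow> 'x::real_inner) \<Rightarrow> ('y \<Rightarrow> 'x set) \<Rightarrow> ('y \<Rightarrow> 'x \<Rightarrow> 'x) \<Rightarrow>
     ('y \<Rightarrow> 'x) \<Rightarrow> ('y \<Rightarrow> 'x \<Rightarrow> 'x) \<Rightarrow> (real \<Rightarrow> real) \<Rightarrow> bool" where
  "K2 \<iota> DA A S B MB \<longleftrightarrow>
     linear S \<and> (\<forall>y. norm (S y) = norm y) \<and> self_adjoint_graph (range (\<lambda>y. (\<iota> y, S y))) \<and>
     (\<forall>y. linear (B y) \<and>
          {(S w, S z) | w z. \<iota> w \<in> DA y \<and> A y (\<iota> w) = \<iota> z} =
            op_graph (DA y) (\<lambda>v. A y v + B y v)) \<and>
     (\<forall>R>0. \<forall>y v. norm y \<le> R \<longrightarrow> norm (B y v) \<le> MB R * norm v)"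

definition K3 ::
    "('y::real_inner \<Rightarrow> 'x::real_inner) \<Rightarrow> ('y \<Rightarrow> 'x \<Rightarrow> 'x) \<Rightarrow> ('y \<Rightarrow> 'x \<Rightarrow> 'x) \<Rightarrow>
     (real \<Rightarrow> real) \<Rightarrow> (real \<Rightarrow> real) \<Rightarrow> bool" where
  "K3 \<iota> A B LA LB \<longleftrightarrow>
     (\<forall>R>0. \<forall>y y'. norm y \<le> R \<longrightarrow> norm y' \<le> R \<longrightarrow>
        (\<forall>w. norm (A y (\<iota> w) - A y' (\<iota> w)) \<le> LA R * norm (\<iota> (y - y')) * norm w) \<and>
        (\<forall>v. norm (B y v - B y' v) \<le> LB R * norm (y - y') * norm v))"

section \<open>Runge--Kutta methods\<close>

definition diag_matrix :: "real^'m \<Rightarrow> real^'m^'m" where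
  "diag_matrix d = (\<chi> i j. if i = j then d $ i else 0)"

definition coercive :: "real^'m^'m \<Rightarrow> bool" where
  "coercive a \<longleftrightarrow> invertible a \<and>
     (\<exists>d \<alpha>. (\<forall>i. 0 < d $ i) \<and> 0 < \<alpha> \<and>
        (\<forall>v. inner v ((diag_matrix d ** matrix_inv a) *v v) \<ge> \<alpha> * inner v (diag_matrix d *v v)))"

definition algebraically_stable :: "real^'m^'m \<Rightarrow> real^'m \<Rightarrow> bool" where
  "algebraically_stable a b \<longleftrightarrow> (\<forall>i. 0 < b $ i) \<and>
     (\<forall>v. 0 \<le> inner v ((\<chi> i j. b $ i * a $ i $ j + b $ j * a $ j $ i - b $ i * b $ j) *v v))"

text \<open>
  The derivative \<open>- A(U) U\<close>, denoted by a dot on \<open>U\<close>, is a priori only an element of \<open>X\<close>, so the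
  equations below are equations in \<open>X\<close>. They are stated with defects \<open>D\<close> and \<open>d\<close>; the method itself
  is the case of zero defects.
\<close>

definition rk_deriv :: "('y \<Rightarrow> 'x) \<Rightarrow> ('y \<Rightarrow> 'x \<Rightarrow> 'x) \<Rightarrow> 'y \<Rightarrow> 'x::real_vector" where
  "rk_deriv \<iota> A y = - A y (\<iota> y)"

definition rk_stages ::
    "real^'m^'m \<Rightarrow> ('y \<Rightarrow> 'x::real_vector) \<Rightarrow> ('y \<Rightarrow> 'x \<Rightarrow> 'x) \<Rightarrow> real \<Rightarrow>
     'y \<Rightarrow> ('m \<Rightarrow> 'y) \<Rightarrow> ('m \<Rightarrow> 'y) \<Rightarrow> bool" where
  "rk_stages a \<iota> A \<tau> u U D \<longleftrightarrow>
     (\<forall>i. \<iota> (U i) = \<iota> u + \<tau> *\<^sub>R (\<Sum>j\<in>UNIV. a $ i $ j *\<^sub>R rk_deriv \<iota> A (U j)) + \<iota> (D i))"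

definition rk_update ::
    "real^'m \<Rightarrow> ('y \<Rightarrow> 'x::real_vector) \<Rightarrow> ('y \<Rightarrow> 'x \<Rightarrow> 'x) \<Rightarrow> real \<Rightarrow>
     'y \<Rightarrow> ('m \<Rightarrow> 'y) \<Rightarrow> 'y \<Rightarrow> 'y \<Rightarrow> bool" where
  "rk_update b \<iota> A \<tau> u U d u' \<longleftrightarrow>
     \<iota> u' = \<iota> u + \<tau> *\<^sub>R (\<Sum>i\<in>UNIV. b $ i *\<^sub>R rk_deriv \<iota> A (U i)) + \<iota> d"

definition stage_bounds ::
    "('y::real_normed_vector \<Rightarrow> 'x::real_normed_vector) \<Rightarrow> real \<Rightarrow> 'y \<Rightarrow> ('m \<Rightarrow> 'y) \<Rightarrow> bool" where
  "stage_bounds \<iota> Cstar u U \<longleftrightarrow>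
     (\<forall>i. norm (\<iota> (U i)) \<le> Cstar * norm (\<iota> u) \<and> norm (U i) \<le> Cstar * norm u)"

text \<open>The defining property of the constant \<open>C\<^sub>*\<close> that singles out the stages of the numerical solution.\<close>

definition stage_constant ::
    "real^'m^'m \<Rightarrow> ('y::real_normed_vector \<Rightarrow> 'x::real_normed_vector) \<Rightarrow> ('y \<Rightarrow> 'x \<Rightarrow> 'x) \<Rightarrow> real \<Rightarrow> bool" where
  "stage_constant a \<iota> A Cstar \<longleftrightarrow>
     (\<forall>\<rho>>0. \<exists>\<tau>\<^sub>0>0. \<forall>\<tau> u. 0 < \<tau> \<longrightarrow> \<tau> \<le> \<tau>\<^sub>0 \<longrightarrow> norm u \<le> \<rho> \<longrightarrow>
        (\<exists>!U. rk_stages a \<iota> A \<tau> u U (\<lambda>_. 0) \<and> stage_bounds \<iota> Cstar u U))"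

definition numerical_solution ::
    "real^'m^'m \<Rightarrow> real^'m \<Rightarrow> ('y::real_normed_vector \<Rightarrow> 'x::real_normed_vector) \<Rightarrow>
     ('y \<Rightarrow> 'x \<Rightarrow> 'x) \<Rightarrow> real \<Rightarrow> real \<Rightarrow> real \<Rightarrow> (nat \<Rightarrow> 'y) \<Rightarrow> (nat \<Rightarrow> 'm \<Rightarrow> 'y) \<Rightarrow> bool" where
  "numerical_solution a b \<iota> A Cstar T \<tau> u U \<longleftrightarrow>
     (\<forall>n. real n * \<tau> \<le> T \<longrightarrow>
        rk_stages a \<iota> A \<tau> (u n) (U n) (\<lambda>_. 0) \<and> stage_bounds \<iota> Cstar (u n) (U n) \<and>
        rk_update b \<iota> A \<tau> (u n) (U n) 0 (u (Suc n)))"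

definition perturbed_solution ::
    "real^'m^'m \<Rightarrow> real^'m \<Rightarrow> ('y::real_normed_vector \<Rightarrow> 'x::real_normed_vector) \<Rightarrow>
     ('y \<Rightarrow> 'x \<Rightarrow> 'x) \<Rightarrow> real \<Rightarrow> real \<Rightarrow> (nat \<Rightarrow> 'y) \<Rightarrow> (nat \<Rightarrow> 'm \<Rightarrow> 'y) \<Rightarrow>
     (nat \<Rightarrow> 'm \<Rightarrow> 'y) \<Rightarrow> (nat \<Rightarrow> 'y) \<Rightarrow> bool" where
  "perturbed_solution a b \<iota> A T \<tau> u U D d \<longleftrightarrow>
     (\<forall>n. real n * \<tau> \<le> T \<longrightarrow>
        rk_stages a \<iota> A \<tau> (u n) (U n) (D n) \<and>
        rk_update b \<iota> A \<tau> (u n) (U n) (d (Suc n)) (u (Suc n)))"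

end

theory Submission imports Defs begin

text \<open>
  Write \<open>e\<^sub>n = u\<^sub>n - u\<^sub>n\<^sup>\<star>\<close>, and let \<open>G\<^sub>i\<close> be the difference of the two stage derivatives. The decisive choice is
  to work with \<open>F\<^sub>i = U\<^sub>n\<^sub>i - U\<^sub>n\<^sub>i\<^sup>\<star> + D\<^sub>n\<^sub>i\<close>, not with the stage error itself: then \<open>F\<close> and \<open>G\<close> satisfy the
  Runge--Kutta equations \<open>F\<^sub>i = e\<^sub>n + \<tau> \<Sum>\<^sub>j a\<^sub>i\<^sub>j G\<^sub>j\<close> without a defect, and the stage defect moves into \<open>G\<close>,
  where it appears as \<open>A(U\<^sub>n\<^sub>i) D\<^sub>n\<^sub>i\<close>, which is controlled by one norm more of \<open>D\<^sub>n\<^sub>i\<close> and carries a factor \<open>\<tau>\<close>.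

  The monotonicity of \<open>A(U\<^sub>n\<^sub>i)\<close> and the Lipschitz bounds give the one-sided estimate
  \<open>(F\<^sub>i, G\<^sub>i) \<le> c |F\<^sub>i| (|F\<^sub>i| + p\<^sub>i)\<close>, where \<open>p\<^sub>i\<close> measures \<open>D\<^sub>n\<^sub>i\<close>. In \<open>X\<close> this is \<open>error_dissipation_X\<close>. In \<open>Y\<close>, where
  \<open>\<parallel>y\<parallel> = |S y|\<close>, one applies \<open>S\<close> to all equations; \<open>S A = (A + B) S\<close> turns them into equations in \<open>X\<close> of the
  same kind, and the term \<open>(A(U) - A(U\<^sup>\<star>)) S U\<^sup>\<star>\<close> is where \<open>\<parallel>S U\<^sup>\<star>\<parallel> \<le> K\<close> enters
  (\<open>error_dissipation_Y\<close>).

  From here on only Hilbert space geometry is used, and it is the same for both norms. Coercivity bounds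
  the \<open>F\<^sub>i\<close> by \<open>e\<^sub>n\<close> and the \<open>p\<^sub>i\<close> (\<open>coercive_stage_bound\<close>); algebraic stability bounds the increment of
  \<open>|e|\<^sup>2\<close> over a step by \<open>2 \<tau> \<Sum>\<^sub>i b\<^sub>i (F\<^sub>i, G\<^sub>i)\<close> (\<open>algebraically_stable_increment\<close>). Together they give the
  recursion \<open>|e\<^sub>n\<^sub>+\<^sub>1|\<^sup>2 \<le> (1 + C \<tau>) |e\<^sub>n|\<^sup>2 + C \<tau> (\<Sum>\<^sub>i p\<^sub>i\<^sup>2 + |d\<^sub>n\<^sub>+\<^sub>1 / \<tau>|\<^sup>2)\<close> (\<open>one_step_stability\<close>), and Gronwall's
  inequality finishes the estimate.

  The constants are those of the ball that contains the stages \<open>U\<^sub>n\<^sub>i\<close>. Since \<open>\<parallel>U\<^sub>n\<^sub>i\<parallel> \<le> C\<^sub>* \<parallel>u\<^sub>n\<parallel>\<close>, a fixed ball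
  suffices as long as \<open>\<parallel>e\<^sub>n\<parallel> \<le> 1\<close>. The \<open>Y\<close>-estimate itself propagates this bound from step to step when
  \<open>\<delta>\<close> is small compared with its constant, so the argument closes by induction on \<open>n\<close>.
\<close>

section \<open>Quadratic forms in an inner product space\<close>

text \<open>
  Gram--Schmidt in a space of any dimension. Inner products of finitely many vectors thereby become
  finite sums of products of real coordinates.
\<close>

lemma finite_orthonormal_expansion:
  fixes I :: "'x::real_inner set"
  assumes "finite I"
  shows "\<exists>Q. finite Q \<and> (\<forall>q\<in>Q. norm q = 1) \<and> (\<forall>q\<in>Q. \<forall>r\<in>Q. q \<noteq> r \<longrightarrow> inner q r = 0) \<and>
    (\<forall>x\<in>I. x = (\<Sum>q\<in>Q. inner x q *\<^sub>R q))"
  using assms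
proof (induction I rule: finite_induct)
  case empty
  show ?case by (intro exI[of _ "{}"]) auto
next
  case (insert x I)
  obtain Q where Q: "finite Q" "\<forall>q\<in>Q. norm q = 1" "\<forall>q\<in>Q. \<forall>r\<in>Q. q \<noteq> r \<longrightarrow> inner q r = 0"
    and "\<forall>y\<in>I. y = (\<Sum>q\<in>Q. inner y q *\<^sub>R q)"
    using insert.IH by (elim exE conjE)
  note I = bspec[OF this(4)]
  define p where "p = (\<Sum>q\<in>Q. inner x q *\<^sub>R q)"
  have orth: "inner (x - p) r = 0" if "r \<in> Q" for r
  proof -
    have "inner p r = (\<Sum>q\<in>Q. inner x q * inner q r)"
      by (simp add: p_def inner_sum_left)
    also have "\<dots> = (\<Sum>q\<in>Q. if q = r then inner x r else 0)"
      using Q(2,3) that by (intro sum.cong) (auto simp: dot_square_norm)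
    also have "\<dots> = inner x r"
      using Q(1) that by simp
    finally show ?thesis by (simp add: inner_diff_left)
  qed
  show ?case
  proof (cases "x = p")
    case True
    have "\<forall>y\<in>insert x I. y = (\<Sum>q\<in>Q. inner y q *\<^sub>R q)"
      by (rule ballI, erule insertE) (simp_all only: True[unfolded p_def, symmetric] I[symmetric])
    with Q show ?thesis by (intro exI[of _ Q] conjI)
  next
    case False
    define s where "s = norm (x - p)"
    have s: "s > 0" using False by (simp add: s_def)
    define q where "q = (x - p) /\<^sub>R s"
    have qn: "norm q = 1" using s by (simp add: q_def s_def)
    have qo: "inner q r = 0" if "r \<in> Q" for r using orth[OF that] by (simp add: q_def)
    have qo': "inner r q = 0" if "r \<in> Q" for r using qo[OF that] by (simp add: inner_commute)
    have qQ: "q \<notin> Q" using qo[of q] qn by (auto simp: dot_square_norm)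
    have pq: "inner p q = 0" by (simp add: p_def inner_sum_left qo')
    have "inner x q = inner (x - p) q" using pq by (simp add: inner_diff_left)
    also have "\<dots> = inner (s *\<^sub>R q) q" using s by (simp add: q_def)
    also have "\<dots> = s" using qn by (simp add: dot_square_norm)
    finally have xq: "inner x q = s" .
    have x: "x = (\<Sum>r\<in>insert q Q. inner x r *\<^sub>R r)"
      using Q(1) qQ s by (simp add: xq p_def[symmetric]) (simp add: q_def)
    have old: "y = (\<Sum>r\<in>insert q Q. inner y r *\<^sub>R r)" if "y \<in> I" for y
    proof -
      have "inner y q = inner (\<Sum>r\<in>Q. inner y r *\<^sub>R r) q"
        by (rule arg_cong[where f = "\<lambda>z. inner z q", OF I[OF that]])
      also have "\<dots> = 0" by (simp add: inner_sum_left qo')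
      finally have "inner y q = 0" .
      then have "(\<Sum>r\<in>insert q Q. inner y r *\<^sub>R r) = (\<Sum>r\<in>Q. inner y r *\<^sub>R r)"
        using Q(1) qQ by simp
      then show ?thesis using I[OF that] by (rule trans[OF _ sym, rotated])
    qed
    show ?thesis
    proof (intro exI[of _ "insert q Q"] conjI)
      show "\<forall>y\<in>insert x I. y = (\<Sum>r\<in>insert q Q. inner y r *\<^sub>R r)"
        by (rule ballI, erule insertE) (simp_all only: x[symmetric] old[symmetric])
    qed (use Q qn qo qo' in auto)
  qed
qed

text \<open>
  Matrix hypotheses of a Runge--Kutta method speak of real vectors, but the stages lie in a Hilbert
  space: in orthonormal coordinates the form on stages is a sum of the real forms of the coordinates.
\<close>

lemma nonneg_quadratic_form_inner:
  fixes M :: "real^'m^'m" and x :: "'m \<Rightarrow> 'x::real_inner"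
  assumes "\<And>v. 0 \<le> inner v (M *v v)"
  shows "0 \<le> (\<Sum>i\<in>UNIV. \<Sum>j\<in>UNIV. M $ i $ j * inner (x i) (x j))"
proof -
  obtain Q where "\<forall>y\<in>range x. y = (\<Sum>q\<in>Q. inner y q *\<^sub>R q)"
    using finite_orthonormal_expansion[of "range x", OF finite_imageI[OF finite]] by (elim exE conjE)
  note Q = bspec[OF this rangeI]
  have eq: "inner (x i) (x j) = (\<Sum>q\<in>Q. inner (x i) q * inner (x j) q)" for i j
  proof -
    have "inner (x i) (x j) = inner (\<Sum>q\<in>Q. inner (x i) q *\<^sub>R q) (x j)"
      by (rule arg_cong[where f = "\<lambda>z. inner z (x j)", OF Q])
    also have "\<dots> = (\<Sum>q\<in>Q. inner (x i) q * inner (x j) q)"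
      by (simp only: inner_sum_left inner_scaleR_left inner_commute[of "x j"])
    finally show ?thesis .
  qed
  have "(\<Sum>i\<in>UNIV. \<Sum>j\<in>UNIV. M $ i $ j * inner (x i) (x j)) =
      (\<Sum>i\<in>UNIV. \<Sum>j\<in>UNIV. \<Sum>q\<in>Q. M $ i $ j * (inner (x i) q * inner (x j) q))"
    by (simp add: eq sum_distrib_left)
  also have "\<dots> = (\<Sum>i\<in>UNIV. \<Sum>q\<in>Q. \<Sum>j\<in>UNIV. M $ i $ j * (inner (x i) q * inner (x j) q))"
    by (intro sum.cong refl sum.swap)
  also have "\<dots> = (\<Sum>q\<in>Q. \<Sum>i\<in>UNIV. \<Sum>j\<in>UNIV. M $ i $ j * (inner (x i) q * inner (x j) q))"
    by (rule sum.swap)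
  also have "\<dots> = (\<Sum>q\<in>Q. inner (\<chi> i. inner (x i) q) (M *v (\<chi> i. inner (x i) q)))"
    by (simp add: inner_vec_def matrix_vector_mult_def sum_distrib_left mult_ac)
  also have "\<dots> \<ge> 0"
    by (intro sum_nonneg assms)
  finally show ?thesis .
qed

section \<open>One step of the method\<close>

lemma matrix_inv_sum_scaleR:
  fixes a :: "real^'m^'m" and g :: "'m \<Rightarrow> 'x::real_vector"
  assumes "invertible a"
  shows "(\<Sum>j\<in>UNIV. matrix_inv a $ i $ j *\<^sub>R (\<Sum>k\<in>UNIV. a $ j $ k *\<^sub>R g k)) = g i"
proof -
  have inv: "(\<Sum>j\<in>UNIV. matrix_inv a $ i $ j * a $ j $ k) = (if i = k then 1 else 0)" for k
  proof -
    have "(matrix_inv a ** a) $ i $ k = mat 1 $ i $ k"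
      using assms someI_ex[of "\<lambda>A'. a ** A' = mat 1 \<and> A' ** a = mat 1"]
      by (simp add: invertible_def matrix_inv_def)
    then show ?thesis by (simp add: matrix_matrix_mult_def mat_def)
  qed
  have "(\<Sum>j\<in>UNIV. matrix_inv a $ i $ j *\<^sub>R (\<Sum>k\<in>UNIV. a $ j $ k *\<^sub>R g k)) =
      (\<Sum>j\<in>UNIV. \<Sum>k\<in>UNIV. (matrix_inv a $ i $ j * a $ j $ k) *\<^sub>R g k)"
    by (simp add: scaleR_sum_right)
  also have "\<dots> = (\<Sum>k\<in>UNIV. (\<Sum>j\<in>UNIV. matrix_inv a $ i $ j * a $ j $ k) *\<^sub>R g k)"
    by (subst sum.swap) (simp add: scaleR_sum_left)
  also have "\<dots> = (\<Sum>k\<in>UNIV. if i = k then g k else 0)"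
    by (intro sum.cong refl) (simp add: inv)
  also have "\<dots> = g i" by simp
  finally show ?thesis .
qed

lemma young_product:
  fixes x y \<epsilon> :: real
  assumes "\<epsilon> > 0"
  shows "x * y \<le> \<epsilon> / 4 * x\<^sup>2 + y\<^sup>2 / \<epsilon>"
proof -
  have "0 \<le> (\<epsilon> * x - 2 * y)\<^sup>2 / (4 * \<epsilon>)" using assms by simp
  also have "\<dots> = \<epsilon> / 4 * x\<^sup>2 + y\<^sup>2 / \<epsilon> - x * y"
    using assms by (simp add: power2_eq_square field_simps)
  finally show ?thesis by simp
qed

text \<open>
  The inverse matrix applied to the stage equations gives \<open>\<Sum>\<^sub>j W\<^sub>i\<^sub>j F\<^sub>j = w\<^sub>i e + \<tau> G\<^sub>i\<close> with \<open>w\<^sub>i = \<Sum>\<^sub>j W\<^sub>i\<^sub>j\<close>.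
  Testing with \<open>d\<^sub>i F\<^sub>i\<close>, coercivity bounds the left-hand side below by \<open>\<alpha> \<Sum>\<^sub>i d\<^sub>i |F\<^sub>i|\<^sup>2\<close>; Young's inequality
  absorbs three quarters of this from the right-hand side when \<open>\<tau>\<close> is small compared with \<open>1 / c\<close>.
\<close>

lemma coercive_stage_bound:
  fixes a :: "real^'m^'m"
  assumes "coercive a" and "c \<ge> 0"
  obtains \<tau>\<^sub>1 C where "\<tau>\<^sub>1 > 0" "C > 0" "\<forall>\<tau> (e::'x::real_inner) F G p.
    0 < \<tau> \<longrightarrow> \<tau> \<le> \<tau>\<^sub>1 \<longrightarrow> (\<forall>i. F i = e + \<tau> *\<^sub>R (\<Sum>j\<in>UNIV. a $ i $ j *\<^sub>R G j)) \<longrightarrow>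
    (\<forall>i. 0 \<le> p i \<and> inner (F i) (G i) \<le> c * norm (F i) * (norm (F i) + p i)) \<longrightarrow>
    (\<Sum>i\<in>UNIV. (norm (F i))\<^sup>2) \<le> C * ((norm e)\<^sup>2 + (\<Sum>i\<in>UNIV. (p i)\<^sup>2))"
proof -
  define W where "W = matrix_inv a"
  from assms(1) obtain d \<alpha> where inv: "invertible a" and d: "\<And>i. 0 < d $ i" and \<alpha>: "0 < \<alpha>"
    and coer: "\<And>v. inner v ((diag_matrix d ** W) *v v) \<ge> \<alpha> * inner v (diag_matrix d *v v)"
    unfolding coercive_def W_def by blast
  define w where "w i = (\<Sum>j\<in>UNIV. W $ i $ j)" for i
  define m where "m = Min (range (\<lambda>i. d $ i))"
  have m: "m > 0" "\<And>i. m \<le> d $ i" using d by (auto simp: m_def)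
  define C where "C = (4 / (\<alpha> * m)) * (1 + (\<Sum>i\<in>UNIV. d $ i * ((w i)\<^sup>2 + 1)) / \<alpha>)"
  have dsum: "0 \<le> (\<Sum>i\<in>UNIV. d $ i * ((w i)\<^sup>2 + 1))"
    by (intro sum_nonneg mult_nonneg_nonneg) (simp_all add: less_imp_le[OF d])
  have C: "C > 0" unfolding C_def using \<alpha> m dsum by (intro mult_pos_pos) (auto intro: add_pos_nonneg)
  have bound: "(\<Sum>i\<in>UNIV. (norm (F i))\<^sup>2) \<le> C * ((norm e)\<^sup>2 + (\<Sum>i\<in>UNIV. (p i)\<^sup>2))"
    if \<tau>: "0 < \<tau>" "\<tau> \<le> \<alpha> / (4 * (c + 1))" "\<tau> \<le> 1 / (c + 1)"
      and F: "\<And>i. F i = e + \<tau> *\<^sub>R (\<Sum>j\<in>UNIV. a $ i $ j *\<^sub>R G j)"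
      and p: "\<And>i. 0 \<le> p i"
      and G: "\<And>i. inner (F i) (G i) \<le> c * norm (F i) * (norm (F i) + p i)"
    for \<tau> and e :: 'x and F G p
  proof -
    have "\<tau> * (c + 1) \<le> \<alpha> / 4" "\<tau> * (c + 1) \<le> 1" using \<tau> assms(2) by (auto simp: field_simps)
    then have tc': "\<tau> * c \<le> \<alpha> / 4" "\<tau> * c \<le> 1"
      using \<tau>(1) by (auto simp: distrib_left)
    have WF: "(\<Sum>j\<in>UNIV. W $ i $ j *\<^sub>R F j) = w i *\<^sub>R e + \<tau> *\<^sub>R G i" for i
    proof -
      have "(\<Sum>j\<in>UNIV. W $ i $ j *\<^sub>R F j) = w i *\<^sub>R e +
          \<tau> *\<^sub>R (\<Sum>j\<in>UNIV. W $ i $ j *\<^sub>R (\<Sum>k\<in>UNIV. a $ j $ k *\<^sub>R G k))"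
        by (subst F) (simp add: w_def scaleR_add_right sum.distrib scaleR_sum_left
            scaleR_sum_right mult_ac)
      then show ?thesis by (simp only: W_def matrix_inv_sum_scaleR[OF inv])
    qed
    \<comment> \<open>coercivity says that the quadratic form of this matrix is nonnegative\<close>
    define M where "M = diag_matrix d ** W - \<alpha> *\<^sub>R diag_matrix d"
    have M: "M $ i $ j = d $ i * W $ i $ j - (if i = j then \<alpha> * d $ i else 0)" for i j
    proof -
      have "(diag_matrix d ** W) $ i $ j = (\<Sum>k\<in>UNIV. if i = k then d $ i * W $ k $ j else 0)"
        unfolding matrix_matrix_mult_def diag_matrix_def
        by (simp add: if_distrib[of "\<lambda>x. x * _"] cong: if_cong)
      then show ?thesis by (simp add: M_def diag_matrix_def)
    qed
    have "0 \<le> inner v (M *v v)" for v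
      using coer[of v] by (simp add: M_def matrix_vector_mult_diff_rdistrib inner_diff_right
          scaleR_matrix_vector_assoc[symmetric])
    from nonneg_quadratic_form_inner[OF this, of F]
    also have "(\<Sum>i\<in>UNIV. \<Sum>j\<in>UNIV. M $ i $ j * inner (F i) (F j)) =
        (\<Sum>i\<in>UNIV. d $ i * inner (F i) (\<Sum>j\<in>UNIV. W $ i $ j *\<^sub>R F j)
          - \<alpha> * (d $ i * (norm (F i))\<^sup>2))"
    proof (intro sum.cong refl)
      fix i
      have "(\<Sum>j\<in>UNIV. M $ i $ j * inner (F i) (F j)) =
          (\<Sum>j\<in>UNIV. d $ i * (W $ i $ j * inner (F i) (F j))
            - (if i = j then \<alpha> * (d $ i * (norm (F i))\<^sup>2) else 0))"
        by (intro sum.cong refl) (simp add: M left_diff_distrib dot_square_norm)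
      then show "(\<Sum>j\<in>UNIV. M $ i $ j * inner (F i) (F j)) =
          d $ i * inner (F i) (\<Sum>j\<in>UNIV. W $ i $ j *\<^sub>R F j) - \<alpha> * (d $ i * (norm (F i))\<^sup>2)"
        by (simp add: sum_subtractf inner_sum_right sum_distrib_left)
    qed
    finally have "0 \<le> (\<Sum>i\<in>UNIV. d $ i * inner (F i) (\<Sum>j\<in>UNIV. W $ i $ j *\<^sub>R F j)
          - \<alpha> * (d $ i * (norm (F i))\<^sup>2))" .
    then have main: "\<alpha> * (\<Sum>i\<in>UNIV. d $ i * (norm (F i))\<^sup>2) \<le>
        (\<Sum>i\<in>UNIV. d $ i * (w i * inner (F i) e + \<tau> * inner (F i) (G i)))"
      by (simp add: WF inner_add_right sum_subtractf sum_distrib_left)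
    have young: "w i * inner (F i) e + \<tau> * inner (F i) (G i) \<le>
        3 * \<alpha> / 4 * (norm (F i))\<^sup>2 + ((w i)\<^sup>2 * (norm e)\<^sup>2 + (p i)\<^sup>2) / \<alpha>" for i
    proof -
      have "w i * inner (F i) e \<le> \<bar>w i * inner (F i) e\<bar>" by simp
      also have "\<dots> \<le> \<bar>w i\<bar> * (norm (F i) * norm e)"
        unfolding abs_mult by (intro mult_left_mono Cauchy_Schwarz_ineq2) simp
      also have "\<dots> = norm (F i) * (\<bar>w i\<bar> * norm e)" by simp
      also have "\<dots> \<le> \<alpha> / 4 * (norm (F i))\<^sup>2 + (\<bar>w i\<bar> * norm e)\<^sup>2 / \<alpha>"
        by (rule young_product[OF \<alpha>])
      finally have 1: "w i * inner (F i) e \<le> \<alpha> / 4 * (norm (F i))\<^sup>2 + (w i)\<^sup>2 * (norm e)\<^sup>2 / \<alpha>"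
        by (simp add: power_mult_distrib)
      have "\<tau> * inner (F i) (G i) \<le> \<tau> * (c * norm (F i) * (norm (F i) + p i))"
        using \<tau> by (intro mult_left_mono G) simp
      also have "\<dots> = \<tau> * c * (norm (F i))\<^sup>2 + \<tau> * c * (norm (F i) * p i)"
        by (simp add: algebra_simps power2_eq_square)
      also have "\<dots> \<le> \<alpha> / 4 * (norm (F i))\<^sup>2 + 1 * (norm (F i) * p i)"
        using tc' p[of i] by (intro add_mono mult_right_mono) auto
      also have "norm (F i) * p i \<le> \<alpha> / 4 * (norm (F i))\<^sup>2 + (p i)\<^sup>2 / \<alpha>"
        by (rule young_product[OF \<alpha>])
      finally show ?thesis using 1 by (simp add: add_divide_distrib)
    qed
    have "\<alpha> * (\<Sum>i\<in>UNIV. d $ i * (norm (F i))\<^sup>2) \<le>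
        (\<Sum>i\<in>UNIV. d $ i * (3 * \<alpha> / 4 * (norm (F i))\<^sup>2 + ((w i)\<^sup>2 * (norm e)\<^sup>2 + (p i)\<^sup>2) / \<alpha>))"
      by (rule order_trans[OF main]) (intro sum_mono mult_left_mono young less_imp_le[OF d])
    also have "\<dots> = 3 * \<alpha> / 4 * (\<Sum>i\<in>UNIV. d $ i * (norm (F i))\<^sup>2) +
        (\<Sum>i\<in>UNIV. d $ i * ((w i)\<^sup>2 * (norm e)\<^sup>2 + (p i)\<^sup>2)) / \<alpha>"
      by (simp add: distrib_left sum.distrib sum_distrib_left sum_divide_distrib add_divide_distrib
          mult_ac)
    finally have "\<alpha> / 4 * (\<Sum>i\<in>UNIV. d $ i * (norm (F i))\<^sup>2) \<le>
        (\<Sum>i\<in>UNIV. d $ i * ((w i)\<^sup>2 * (norm e)\<^sup>2 + (p i)\<^sup>2)) / \<alpha>"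
      by linarith
    also have "\<dots> \<le> (\<Sum>i\<in>UNIV. d $ i * ((w i)\<^sup>2 + 1) *
        ((norm e)\<^sup>2 + (\<Sum>i\<in>UNIV. (p i)\<^sup>2))) / \<alpha>"
    proof (intro divide_right_mono sum_mono)
      fix i
      have "(p i)\<^sup>2 \<le> (\<Sum>i\<in>UNIV. (p i)\<^sup>2)" by (rule member_le_sum) auto
      moreover have "0 \<le> (w i)\<^sup>2 * (\<Sum>i\<in>UNIV. (p i)\<^sup>2)" by (simp add: sum_nonneg)
      ultimately have "(w i)\<^sup>2 * (norm e)\<^sup>2 + (p i)\<^sup>2 \<le>
          ((w i)\<^sup>2 + 1) * ((norm e)\<^sup>2 + (\<Sum>i\<in>UNIV. (p i)\<^sup>2))"
        using zero_le_power2[of "norm e"] unfolding distrib_left distrib_right by linarith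
      then show "d $ i * ((w i)\<^sup>2 * (norm e)\<^sup>2 + (p i)\<^sup>2) \<le>
          d $ i * ((w i)\<^sup>2 + 1) * ((norm e)\<^sup>2 + (\<Sum>i\<in>UNIV. (p i)\<^sup>2))"
        using d[of i] by (simp add: mult.assoc)
    qed (use \<alpha> in simp)
    also have "\<dots> \<le> (1 + (\<Sum>i\<in>UNIV. d $ i * ((w i)\<^sup>2 + 1)) / \<alpha>) *
        ((norm e)\<^sup>2 + (\<Sum>i\<in>UNIV. (p i)\<^sup>2))"
      by (simp add: sum_distrib_right[symmetric] distrib_right sum_nonneg)
    finally have "\<alpha> / 4 * (\<Sum>i\<in>UNIV. d $ i * (norm (F i))\<^sup>2) \<le>
        (1 + (\<Sum>i\<in>UNIV. d $ i * ((w i)\<^sup>2 + 1)) / \<alpha>) * ((norm e)\<^sup>2 + (\<Sum>i\<in>UNIV. (p i)\<^sup>2))" .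
    moreover have "m * (\<Sum>i\<in>UNIV. (norm (F i))\<^sup>2) \<le> (\<Sum>i\<in>UNIV. d $ i * (norm (F i))\<^sup>2)"
      unfolding sum_distrib_left by (intro sum_mono mult_right_mono m) simp
    then have "\<alpha> / 4 * (m * (\<Sum>i\<in>UNIV. (norm (F i))\<^sup>2)) \<le>
        \<alpha> / 4 * (\<Sum>i\<in>UNIV. d $ i * (norm (F i))\<^sup>2)"
      using \<alpha> by (intro mult_left_mono) auto
    ultimately have *: "\<alpha> / 4 * (m * (\<Sum>i\<in>UNIV. (norm (F i))\<^sup>2)) \<le>
        (1 + (\<Sum>i\<in>UNIV. d $ i * ((w i)\<^sup>2 + 1)) / \<alpha>) * ((norm e)\<^sup>2 + (\<Sum>i\<in>UNIV. (p i)\<^sup>2))"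
      by linarith
    have "(\<Sum>i\<in>UNIV. (norm (F i))\<^sup>2) =
        4 / (\<alpha> * m) * (\<alpha> / 4 * (m * (\<Sum>i\<in>UNIV. (norm (F i))\<^sup>2)))"
      using \<alpha> m by simp
    also have "\<dots> \<le> 4 / (\<alpha> * m) * ((1 + (\<Sum>i\<in>UNIV. d $ i * ((w i)\<^sup>2 + 1)) / \<alpha>) *
        ((norm e)\<^sup>2 + (\<Sum>i\<in>UNIV. (p i)\<^sup>2)))"
      using \<alpha> m * by (intro mult_left_mono) auto
    finally show ?thesis by (simp only: C_def mult.assoc)
  qed
  show thesis
  proof (rule that)
    show "0 < min (\<alpha> / (4 * (c + 1))) (1 / (c + 1))" using \<alpha> assms(2) by simp
  qed (use C bound in auto)
qed

text \<open>
  In the expansion of \<open>|e + \<tau> \<Sum>\<^sub>i b\<^sub>i G\<^sub>i|\<^sup>2\<close>, replace \<open>e\<close> in \<open>(e, G\<^sub>i)\<close> by \<open>F\<^sub>i - \<tau> \<Sum>\<^sub>j a\<^sub>i\<^sub>j G\<^sub>j\<close>. The terms of order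
  \<open>\<tau>\<^sup>2\<close> are then minus the form of the algebraic stability matrix at \<open>G\<close>.
\<close>

lemma algebraically_stable_increment:
  fixes a :: "real^'m^'m" and e :: "'x::real_inner"
  assumes "algebraically_stable a b"
    and F: "\<And>i. F i = e + \<tau> *\<^sub>R (\<Sum>j\<in>UNIV. a $ i $ j *\<^sub>R G j)"
  shows "(norm (e + \<tau> *\<^sub>R (\<Sum>i\<in>UNIV. b $ i *\<^sub>R G i)))\<^sup>2 \<le>
    (norm e)\<^sup>2 + 2 * \<tau> * (\<Sum>i\<in>UNIV. b $ i * inner (F i) (G i))"
proof -
  let ?N = "(\<chi> i j. b $ i * a $ i $ j + b $ j * a $ j $ i - b $ i * b $ j) :: real^'m^'m"
  let ?P = "\<Sum>i\<in>UNIV. \<Sum>j\<in>UNIV. b $ i * a $ i $ j * inner (G i) (G j)"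
  let ?Q = "\<Sum>i\<in>UNIV. \<Sum>j\<in>UNIV. b $ i * b $ j * inner (G i) (G j)"
  have "0 \<le> (\<Sum>i\<in>UNIV. \<Sum>j\<in>UNIV. ?N $ i $ j * inner (G i) (G j))"
    using assms(1) by (intro nonneg_quadratic_form_inner) (simp add: algebraically_stable_def)
  also have "\<dots> = ?P + (\<Sum>i\<in>UNIV. \<Sum>j\<in>UNIV. b $ j * a $ j $ i * inner (G i) (G j)) - ?Q"
    by (simp add: distrib_right left_diff_distrib sum.distrib sum_subtractf)
  also have "(\<Sum>i\<in>UNIV. \<Sum>j\<in>UNIV. b $ j * a $ j $ i * inner (G i) (G j)) = ?P"
    by (subst sum.swap) (simp add: inner_commute)
  finally have PQ: "?Q \<le> 2 * ?P" by simp
  have inn: "inner e (G i) =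
      inner (F i) (G i) - \<tau> * (\<Sum>j\<in>UNIV. a $ i $ j * inner (G i) (G j))" for i
    by (simp add: F inner_add_left inner_sum_left inner_commute[of _ "G i"] inner_add_right
        inner_sum_right)
  have "inner e (\<Sum>i\<in>UNIV. b $ i *\<^sub>R G i) = (\<Sum>i\<in>UNIV. b $ i * inner e (G i))"
    by (simp add: inner_sum_right)
  also have "\<dots> = (\<Sum>i\<in>UNIV. b $ i * inner (F i) (G i)) - \<tau> * ?P"
    by (simp add: inn right_diff_distrib sum_subtractf sum_distrib_left mult_ac)
  finally have cross: "inner e (\<Sum>i\<in>UNIV. b $ i *\<^sub>R G i) =
      (\<Sum>i\<in>UNIV. b $ i * inner (F i) (G i)) - \<tau> * ?P" .
  have sq: "inner (\<Sum>i\<in>UNIV. b $ i *\<^sub>R G i) (\<Sum>i\<in>UNIV. b $ i *\<^sub>R G i) = ?Q"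
    by (simp add: inner_sum_left inner_sum_right sum_distrib_left mult_ac)
      (rule trans[OF sum.swap], simp add: inner_commute mult_ac)
  have "(norm (e + \<tau> *\<^sub>R (\<Sum>i\<in>UNIV. b $ i *\<^sub>R G i)))\<^sup>2 =
      (norm e)\<^sup>2 + 2 * \<tau> * inner e (\<Sum>i\<in>UNIV. b $ i *\<^sub>R G i)
        + \<tau>\<^sup>2 * inner (\<Sum>i\<in>UNIV. b $ i *\<^sub>R G i) (\<Sum>i\<in>UNIV. b $ i *\<^sub>R G i)"
    (is "(norm (e + \<tau> *\<^sub>R ?g))\<^sup>2 = _")
    unfolding power2_norm_eq_inner using inner_commute[of ?g e]
    by (simp only: inner_add_left inner_add_right inner_scaleR_left inner_scaleR_right)
      (simp add: algebra_simps power2_eq_square)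
  also have "\<dots> = (norm e)\<^sup>2 + 2 * \<tau> * (\<Sum>i\<in>UNIV. b $ i * inner (F i) (G i)) - \<tau>\<^sup>2 * (2 * ?P - ?Q)"
    unfolding cross sq by (simp add: algebra_simps power2_eq_square)
  also have "\<dots> \<le> (norm e)\<^sup>2 + 2 * \<tau> * (\<Sum>i\<in>UNIV. b $ i * inner (F i) (G i))"
    using mult_nonneg_nonneg[OF zero_le_power2[of \<tau>], of "2 * ?P - ?Q"] PQ by simp
  finally show ?thesis .
qed

text \<open>
  Young's inequality with weight \<open>\<tau>\<close>: a defect enters only through \<open>\<tau> |y / \<tau>|\<^sup>2\<close>, which sums to a bounded
  quantity over \<open>T / \<tau>\<close> steps, at the cost of a factor \<open>1 + \<tau>\<close> on the propagated error.
\<close>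

lemma norm_diff_square_le:
  fixes x y :: "'x::real_inner"
  assumes "\<tau> > 0"
  shows "(norm (x - y))\<^sup>2 \<le> (1 + \<tau>) * (norm x)\<^sup>2 + \<tau> * (1 + \<tau>) * (norm (y /\<^sub>R \<tau>))\<^sup>2"
proof -
  have n: "\<tau> * (1 + \<tau>) * (norm (y /\<^sub>R \<tau>))\<^sup>2 = (1 + \<tau>) / \<tau> * (norm y)\<^sup>2"
    using assms by (simp add: power_mult_distrib power_divide field_simps power2_eq_square)
  have "(norm (x - y))\<^sup>2 \<le> (norm x + norm y)\<^sup>2"
    by (intro power_mono norm_triangle_ineq4) simp
  also have "\<dots> = (1 + \<tau>) * (norm x)\<^sup>2 + (1 + \<tau>) / \<tau> * (norm y)\<^sup>2 - (\<tau> * norm x - norm y)\<^sup>2 / \<tau>"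
    using assms by (simp add: field_simps power2_eq_square)
  also have "\<dots> \<le> (1 + \<tau>) * (norm x)\<^sup>2 + (1 + \<tau>) / \<tau> * (norm y)\<^sup>2"
    using assms by simp
  finally show ?thesis by (simp only: n)
qed

text \<open>
  This is the only place where both hypotheses on the method are combined. The differential equation
  is visible through the one-sided bound on \<open>(F\<^sub>i, G\<^sub>i)\<close> alone, so the recursion applies to the errors in
  either norm.
\<close>

lemma one_step_stability:
  fixes a :: "real^'m^'m"
  assumes stable: "algebraically_stable a b" and "coercive a" and c: "c \<ge> 0"
  obtains \<tau>\<^sub>1 C where "\<tau>\<^sub>1 > 0" "C \<ge> 1" "\<forall>\<tau> (e::'x::real_inner) F G p f.
    0 < \<tau> \<longrightarrow> \<tau> \<le> \<tau>\<^sub>1 \<longrightarrow> (\<forall>i. F i = e + \<tau> *\<^sub>R (\<Sum>j\<in>UNIV. a $ i $ j *\<^sub>R G j)) \<longrightarrow>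
    (\<forall>i. 0 \<le> p i \<and> inner (F i) (G i) \<le> c * norm (F i) * (norm (F i) + p i)) \<longrightarrow>
    (norm (e + \<tau> *\<^sub>R (\<Sum>i\<in>UNIV. b $ i *\<^sub>R G i) - f))\<^sup>2 \<le>
      (1 + C * \<tau>) * (norm e)\<^sup>2 + C * \<tau> * ((\<Sum>i\<in>UNIV. (p i)\<^sup>2) + (norm (f /\<^sub>R \<tau>))\<^sup>2)"
proof -
  obtain \<tau>\<^sub>1 C\<^sub>0 where \<tau>1: "\<tau>\<^sub>1 > 0" and C0: "C\<^sub>0 > 0" and stage: "\<forall>\<tau> (e::'x) F G p.
    0 < \<tau> \<longrightarrow> \<tau> \<le> \<tau>\<^sub>1 \<longrightarrow> (\<forall>i. F i = e + \<tau> *\<^sub>R (\<Sum>j\<in>UNIV. a $ i $ j *\<^sub>R G j)) \<longrightarrow>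
    (\<forall>i. 0 \<le> p i \<and> inner (F i) (G i) \<le> c * norm (F i) * (norm (F i) + p i)) \<longrightarrow>
    (\<Sum>i\<in>UNIV. (norm (F i))\<^sup>2) \<le> C\<^sub>0 * ((norm e)\<^sup>2 + (\<Sum>i\<in>UNIV. (p i)\<^sup>2))"
    by (rule coercive_stage_bound[OF assms(2,3)])
  have b: "\<And>i. 0 < b $ i" using stable by (simp add: algebraically_stable_def)
  define \<beta> where "\<beta> = (\<Sum>i\<in>UNIV. b $ i)"
  have \<beta>: "0 \<le> \<beta>" "\<And>i. b $ i \<le> \<beta>"
    unfolding \<beta>_def by (auto intro!: sum_nonneg member_le_sum simp: less_imp_le[OF b])
  define C where "C = \<beta> * c * (3 * C\<^sub>0 + 1)"
  have C: "0 \<le> C" using \<beta> c C0 by (simp add: C_def)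
  have "(norm (e + \<tau> *\<^sub>R (\<Sum>i\<in>UNIV. b $ i *\<^sub>R G i) - f))\<^sup>2 \<le>
      (1 + (2 * C + 2) * \<tau>) * (norm e)\<^sup>2 +
        (2 * C + 2) * \<tau> * ((\<Sum>i\<in>UNIV. (p i)\<^sup>2) + (norm (f /\<^sub>R \<tau>))\<^sup>2)"
    if \<tau>: "0 < \<tau>" "\<tau> \<le> \<tau>\<^sub>1" "\<tau> \<le> 1"
      and F: "\<And>i. F i = e + \<tau> *\<^sub>R (\<Sum>j\<in>UNIV. a $ i $ j *\<^sub>R G j)"
      and G: "\<And>i. 0 \<le> p i \<and> inner (F i) (G i) \<le> c * norm (F i) * (norm (F i) + p i)"
    for \<tau> and e f :: 'x and F G p
  proof -
    define P where "P = (\<Sum>i\<in>UNIV. (p i)\<^sup>2)"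
    have P: "0 \<le> P" by (simp add: P_def sum_nonneg)
    have each: "2 * (b $ i * inner (F i) (G i)) \<le> \<beta> * c * (3 * (norm (F i))\<^sup>2 + (p i)\<^sup>2)" for i
    proof -
      have "2 * inner (F i) (G i) \<le> c * (2 * (norm (F i) * (norm (F i) + p i)))"
        using G[of i] by (simp add: mult_ac)
      also have "\<dots> \<le> c * (3 * (norm (F i))\<^sup>2 + (p i)\<^sup>2)"
        using c zero_le_power2[of "norm (F i) - p i"]
        by (intro mult_left_mono) (simp_all add: power2_eq_square algebra_simps)
      finally have "b $ i * (2 * inner (F i) (G i)) \<le> b $ i * (c * (3 * (norm (F i))\<^sup>2 + (p i)\<^sup>2))"
        using b[of i] by simp
      also have "\<dots> \<le> \<beta> * (c * (3 * (norm (F i))\<^sup>2 + (p i)\<^sup>2))"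
        using c \<beta> by (intro mult_right_mono) auto
      finally show ?thesis by (simp add: mult_ac)
    qed
    have "2 * (\<Sum>i\<in>UNIV. b $ i * inner (F i) (G i)) \<le>
        (\<Sum>i\<in>UNIV. \<beta> * c * (3 * (norm (F i))\<^sup>2 + (p i)\<^sup>2))"
      unfolding sum_distrib_left by (intro sum_mono each)
    also have "\<dots> = \<beta> * c * (3 * (\<Sum>i\<in>UNIV. (norm (F i))\<^sup>2) + P)"
      by (simp add: P_def sum_distrib_left sum.distrib distrib_left)
    also have "\<dots> \<le> \<beta> * c * (3 * (C\<^sub>0 * ((norm e)\<^sup>2 + P)) + P)"
      using stage[rule_format, OF \<tau>(1,2) F G] \<beta> c by (intro mult_left_mono) (auto simp: P_def)
    also have "\<dots> \<le> \<beta> * c * ((3 * C\<^sub>0 + 1) * ((norm e)\<^sup>2 + P))"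
      using \<beta> c by (intro mult_left_mono) (auto simp: algebra_simps)
    finally have "2 * (\<Sum>i\<in>UNIV. b $ i * inner (F i) (G i)) \<le> C * ((norm e)\<^sup>2 + P)"
      by (simp only: C_def mult.assoc)
    then have "\<tau> * (2 * (\<Sum>i\<in>UNIV. b $ i * inner (F i) (G i))) \<le> \<tau> * (C * ((norm e)\<^sup>2 + P))"
      using \<tau> by (intro mult_left_mono) auto
    then have "(norm (e + \<tau> *\<^sub>R (\<Sum>i\<in>UNIV. b $ i *\<^sub>R G i)))\<^sup>2 \<le> (norm e)\<^sup>2 + C * \<tau> * ((norm e)\<^sup>2 + P)"
      using algebraically_stable_increment[OF stable F] by (simp add: mult_ac)
    then have "(1 + \<tau>) * (norm (e + \<tau> *\<^sub>R (\<Sum>i\<in>UNIV. b $ i *\<^sub>R G i)))\<^sup>2 \<le>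
        (1 + \<tau>) * ((norm e)\<^sup>2 + C * \<tau> * ((norm e)\<^sup>2 + P))"
      using \<tau> by (intro mult_left_mono) auto
    then have "(norm (e + \<tau> *\<^sub>R (\<Sum>i\<in>UNIV. b $ i *\<^sub>R G i) - f))\<^sup>2 \<le>
        (1 + \<tau>) * ((norm e)\<^sup>2 + C * \<tau> * ((norm e)\<^sup>2 + P)) + \<tau> * (1 + \<tau>) * (norm (f /\<^sub>R \<tau>))\<^sup>2"
      using norm_diff_square_le[OF \<tau>(1), of "e + \<tau> *\<^sub>R (\<Sum>i\<in>UNIV. b $ i *\<^sub>R G i)" f] by linarith
    also have "\<dots> = (1 + \<tau>) * (norm e)\<^sup>2 + (1 + \<tau>) * (C * \<tau> * ((norm e)\<^sup>2 + P))
        + (1 + \<tau>) * (\<tau> * (norm (f /\<^sub>R \<tau>))\<^sup>2)"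
      by (simp add: algebra_simps)
    also have "\<dots> \<le> (1 + \<tau>) * (norm e)\<^sup>2 + 2 * (C * \<tau> * ((norm e)\<^sup>2 + P))
        + 2 * (\<tau> * (norm (f /\<^sub>R \<tau>))\<^sup>2)"
      using \<tau> C P by (intro add_mono mult_right_mono order_refl) auto
    also have "\<dots> \<le> (1 + (2 * C + 2) * \<tau>) * (norm e)\<^sup>2 +
        (2 * C + 2) * \<tau> * (P + (norm (f /\<^sub>R \<tau>))\<^sup>2)"
    proof -
      have "0 \<le> \<tau> * (norm e)\<^sup>2" "0 \<le> \<tau> * P" "0 \<le> C * (\<tau> * (norm (f /\<^sub>R \<tau>))\<^sup>2)"
        using \<tau> P C by auto
      then show ?thesis by (simp add: algebra_simps del: norm_scaleR)
    qed
    finally show ?thesis by (simp add: P_def)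
  qed
  then show thesis
    using \<tau>1 C by (intro that[of "min \<tau>\<^sub>1 1" "2 * C + 2"]) auto
qed

lemma discrete_gronwall:
  fixes x h :: "nat \<Rightarrow> real"
  assumes "C \<ge> 0" "\<tau> \<ge> 0" "\<And>k. 0 \<le> h k" "0 \<le> x 0"
    and "\<And>k. k < n \<Longrightarrow> x (Suc k) \<le> (1 + C * \<tau>) * x k + C * \<tau> * h k"
  shows "x n \<le> exp (C * (real n * \<tau>)) * (x 0 + C * \<tau> * (\<Sum>k<n. h k))"
  using assms(5)
proof (induction n)
  case 0
  then show ?case by simp
next
  case (Suc n)
  define H where "H = x 0 + C * \<tau> * (\<Sum>k<n. h k)"
  have ct: "0 \<le> C * \<tau>" using assms by simp
  have H: "0 \<le> H" using assms by (simp add: H_def sum_nonneg)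
  have split: "exp (C * (real (Suc n) * \<tau>)) = exp (C * \<tau>) * exp (C * (real n * \<tau>))"
    by (simp add: exp_add[symmetric] algebra_simps)
  have "x (Suc n) \<le> (1 + C * \<tau>) * x n + C * \<tau> * h n" using Suc.prems by simp
  also have "\<dots> \<le> (1 + C * \<tau>) * (exp (C * (real n * \<tau>)) * H) + C * \<tau> * h n"
    using Suc ct by (intro add_right_mono mult_left_mono) (auto simp: H_def)
  also have "\<dots> \<le> exp (C * \<tau>) * (exp (C * (real n * \<tau>)) * H)
      + exp (C * (real (Suc n) * \<tau>)) * (C * \<tau> * h n)"
  proof (intro add_mono mult_right_mono)
    show "1 + C * \<tau> \<le> exp (C * \<tau>)" by (rule exp_ge_add_one_self)
    have "0 \<le> C * (real (Suc n) * \<tau>)" using assms(1,2) by simp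
    then have "1 * (C * \<tau> * h n) \<le> exp (C * (real (Suc n) * \<tau>)) * (C * \<tau> * h n)"
      using ct assms(3)[of n] by (intro mult_right_mono) auto
    then show "C * \<tau> * h n \<le> exp (C * (real (Suc n) * \<tau>)) * (C * \<tau> * h n)" by simp
  qed (use H in auto)
  also have "\<dots> = exp (C * (real (Suc n) * \<tau>)) * (x 0 + C * \<tau> * (\<Sum>k<Suc n. h k))"
    unfolding split H_def by (simp add: algebra_simps)
  finally show ?case .
qed

section \<open>The error equation\<close>

lemma closed_linear_operator_diff:
  assumes "closed_linear_operator Dom f" "x \<in> Dom" "y \<in> Dom"
  shows "x - y \<in> Dom \<and> f (x - y) = f x - f y"
proof -
  have "subspace (op_graph Dom f)" using assms(1) by (simp add: closed_linear_operator_def)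
  moreover have "(x, f x) \<in> op_graph Dom f" "(y, f y) \<in> op_graph Dom f"
    using assms by (auto simp: op_graph_def)
  ultimately have "(x, f x) - (y, f y) \<in> op_graph Dom f" by (rule subspace_diff)
  then show ?thesis by (auto simp: op_graph_def)
qed

lemma closed_linear_operator_add:
  assumes "closed_linear_operator Dom f" "x \<in> Dom" "y \<in> Dom"
  shows "x + y \<in> Dom \<and> f (x + y) = f x + f y"
proof -
  have "subspace (op_graph Dom f)" using assms(1) by (simp add: closed_linear_operator_def)
  moreover have "(x, f x) \<in> op_graph Dom f" "(y, f y) \<in> op_graph Dom f"
    using assms by (auto simp: op_graph_def)
  ultimately have "(x, f x) + (y, f y) \<in> op_graph Dom f" by (rule subspace_add)
  then show ?thesis by (auto simp: op_graph_def)
qed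

lemma inner_diff_operator_le:
  fixes w f :: "'x::real_inner"
  assumes "0 \<le> inner w f" and "norm g \<le> r"
  shows "inner w (g - f) \<le> norm w * r"
proof -
  have "inner w g \<le> norm w * norm g" by (rule norm_cauchy_schwarz)
  also have "\<dots> \<le> norm w * r" using assms(2) by (rule mult_left_mono) simp
  finally show ?thesis using assms(1) by (simp add: inner_diff_right)
qed

text \<open>
  The stage equations can be solved for \<open>\<tau>\<close> times the derivatives because the coefficient matrix is
  invertible, and what they are expressed by lies in \<open>Y\<close>. Hence \<open>S\<close> can be applied to the derivatives.
\<close>

lemma rk_deriv_in_range:
  fixes a :: "real^'m^'m"
  assumes "linear \<iota>" "invertible a" "\<tau> \<noteq> 0" "rk_stages a \<iota> A \<tau> u U D"
  shows "\<exists>V. \<forall>i. \<iota> (V i) = rk_deriv \<iota> A (U i)"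
proof -
  define V where "V i = (1 / \<tau>) *\<^sub>R (\<Sum>j\<in>UNIV. matrix_inv a $ i $ j *\<^sub>R (U j - u - D j))" for i
  have "\<iota> (U j - u - D j) = \<tau> *\<^sub>R (\<Sum>k\<in>UNIV. a $ j $ k *\<^sub>R rk_deriv \<iota> A (U k))" for j
    using assms(4) by (simp add: rk_stages_def linear_diff[OF assms(1)])
  then have "\<iota> (V i) = (\<Sum>j\<in>UNIV. matrix_inv a $ i $ j *\<^sub>R
      (\<Sum>k\<in>UNIV. a $ j $ k *\<^sub>R rk_deriv \<iota> A (U k)))" for i
    using assms(3)
    by (simp add: V_def linear_sum[OF assms(1)] linear_scale[OF assms(1)] scaleR_sum_right
        mult_ac)
  then show ?thesis
    by (intro exI[of _ V]) (simp add: matrix_inv_sum_scaleR[OF assms(2)])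
qed

text \<open>
  The equations hold in \<open>Y\<close>, so that each of the linear maps \<open>\<iota>\<close> and \<open>S\<close> transports them to \<open>X\<close>.
\<close>

lemma rk_error_equations:
  fixes a :: "real^'m^'m"
  assumes lin: "linear \<iota>" and inj: "inj \<iota>" and "invertible a" "\<tau> \<noteq> 0"
    and num: "rk_stages a \<iota> A \<tau> u U (\<lambda>_. 0)" "rk_update b \<iota> A \<tau> u U 0 u'"
    and pert: "rk_stages a \<iota> A \<tau> us Us D" "rk_update b \<iota> A \<tau> us Us d us'"
  obtains P Q where "\<And>i. \<iota> (P i) = rk_deriv \<iota> A (U i)" "\<And>i. \<iota> (Q i) = rk_deriv \<iota> A (Us i)"
    "\<And>i. U i - Us i + D i = (u - us) + \<tau> *\<^sub>R (\<Sum>j\<in>UNIV. a $ i $ j *\<^sub>R (P j - Q j))"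
    "u' - us' = (u - us) + \<tau> *\<^sub>R (\<Sum>i\<in>UNIV. b $ i *\<^sub>R (P i - Q i)) - d"
proof -
  note linear_rules = linear_add[OF lin] linear_diff[OF lin] linear_scale[OF lin]
    linear_sum[OF lin] linear_0[OF lin]
  obtain P Q where P: "\<And>i. \<iota> (P i) = rk_deriv \<iota> A (U i)"
    and Q: "\<And>i. \<iota> (Q i) = rk_deriv \<iota> A (Us i)"
    using rk_deriv_in_range[OF lin assms(3,4)] num(1) pert(1) by metis
  have "\<iota> (U i - Us i + D i) =
      \<iota> ((u - us) + \<tau> *\<^sub>R (\<Sum>j\<in>UNIV. a $ i $ j *\<^sub>R (P j - Q j)))" for i
    using num(1) pert(1)
    by (simp add: rk_stages_def linear_rules P Q scaleR_diff_right sum_subtractf)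
  moreover have "\<iota> (u' - us') = \<iota> ((u - us) + \<tau> *\<^sub>R (\<Sum>i\<in>UNIV. b $ i *\<^sub>R (P i - Q i)) - d)"
    using num(2) pert(2)
    by (simp add: rk_update_def linear_rules P Q scaleR_diff_right sum_subtractf)
  ultimately show thesis using that[of P Q] P Q injD[OF inj] by blast
qed

text \<open>
  With \<open>w = U - V + D\<close> the difference of derivatives is
  \<open>- A(U) w + A(U) D - (A(U) - A(V)) V\<close>, whose first term is dissipative.
\<close>

lemma error_dissipation_X:
  fixes \<iota> :: "'y::real_inner \<Rightarrow> 'x::real_inner" and D :: 'y
  assumes emb: "linear \<iota>" "\<And>y. norm (\<iota> y) \<le> norm y"
    and clo: "\<And>y. closed_linear_operator (DA y) (A y)"
    and K1: "K1 \<iota> DA A MA" and K3: "K3 \<iota> A B LA LB"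
    and \<rho>: "0 < \<rho>" "norm U \<le> \<rho>" "norm V \<le> \<rho>"
  defines "w \<equiv> \<iota> (U - V + D)"
  shows "inner w (rk_deriv \<iota> A U - rk_deriv \<iota> A V) \<le>
    (\<bar>MA \<rho>\<bar> + \<bar>LA \<rho>\<bar> * \<rho>) * norm w * (norm w + norm D)"
proof -
  have dom: "\<And>z. \<iota> z \<in> DA U" and mono: "\<And>x. x \<in> DA U \<Longrightarrow> 0 \<le> inner x (A U x)"
    and bound: "\<And>z. norm (A U (\<iota> z)) \<le> MA \<rho> * norm z"
    using K1 \<rho> unfolding K1_def by blast+
  have A: "A U w = A U (\<iota> U) - A U (\<iota> V) + A U (\<iota> D)"
    using closed_linear_operator_diff[OF clo dom[of U] dom[of V]]
      closed_linear_operator_add[OF clo _ dom[of D], of "\<iota> U - \<iota> V"]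
    by (simp add: w_def linear_add[OF emb(1)] linear_diff[OF emb(1)])
  define g where "g = A U (\<iota> D) - (A U (\<iota> V) - A V (\<iota> V))"
  have "norm (\<iota> (U - V)) \<le> norm w + norm (\<iota> D)"
    unfolding w_def linear_add[OF emb(1), of "U - V" D] by (metis add_diff_cancel_right' norm_triangle_ineq4)
  then have diff: "norm (\<iota> (U - V)) \<le> norm w + norm D" using emb(2)[of D] by linarith
  have "norm (A U (\<iota> V) - A V (\<iota> V)) \<le> LA \<rho> * norm (\<iota> (U - V)) * norm V"
    using K3 \<rho> by (auto simp: K3_def)
  also have "\<dots> \<le> \<bar>LA \<rho>\<bar> * (norm w + norm D) * \<rho>"
    using \<rho> diff by (intro mult_mono) auto
  finally have "norm g \<le> \<bar>MA \<rho>\<bar> * norm D + \<bar>LA \<rho>\<bar> * (norm w + norm D) * \<rho>"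
    using bound[of D] norm_triangle_ineq4[of "A U (\<iota> D)" "A U (\<iota> V) - A V (\<iota> V)"]
      mult_right_mono[OF abs_ge_self[of "MA \<rho>"] norm_ge_zero[of D]]
    by (simp add: g_def)
  also have "\<dots> \<le> (\<bar>MA \<rho>\<bar> + \<bar>LA \<rho>\<bar> * \<rho>) * (norm w + norm D)"
    by (simp add: algebra_simps)
  finally have g: "norm g \<le> (\<bar>MA \<rho>\<bar> + \<bar>LA \<rho>\<bar> * \<rho>) * (norm w + norm D)" .
  have "rk_deriv \<iota> A U - rk_deriv \<iota> A V = g - A U w"
    unfolding A g_def by (simp add: rk_deriv_def)
  then show ?thesis
    using inner_diff_operator_le[OF mono g, of w] dom[of "U - V + D"]
    by (simp add: w_def mult_ac)
qed

lemma S_conjugation: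
  assumes "K2 \<iota> DA A S B MB" and "\<iota> w \<in> DA y" and "A y (\<iota> w) = \<iota> z"
  shows "S w \<in> DA y \<and> S z = A y (S w) + B y (S w)"
proof -
  have "(S w, S z) \<in> {(S w, S z) | w z. \<iota> w \<in> DA y \<and> A y (\<iota> w) = \<iota> z}"
    using assms(2,3) by blast
  also have "\<dots> = op_graph (DA y) (\<lambda>v. A y v + B y v)"
    using assms(1) by (simp add: K2_def)
  finally show ?thesis by (auto simp: op_graph_def)
qed

text \<open>
  Conjugation by \<open>S\<close> gives, with \<open>w = S (U - V + D)\<close>,
  \<open>S (P - Q) = - A(U) w + A(U) S D - (A(U) - A(V)) S V - B(U) S (U - V) - (B(U) - B(V)) S V\<close>.
  Everything after the first term is bounded by \<open>\<parallel>U - V\<parallel>\<close> and \<open>\<parallel>S D\<parallel>\<close>; the membership \<open>S V \<in> Y\<close> gives a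
  meaning to \<open>A(U) S V\<close>, and the Lipschitz bound for it costs the norm of \<open>S V\<close> in \<open>Y\<close>.
\<close>

lemma error_dissipation_Y:
  fixes \<iota> :: "'y::real_inner \<Rightarrow> 'x::real_inner" and D :: 'y
  assumes emb: "linear \<iota>" "inj \<iota>" "\<And>y. norm (\<iota> y) \<le> norm y"
    and clo: "\<And>y. closed_linear_operator (DA y) (A y)"
    and K1: "K1 \<iota> DA A MA" and K2: "K2 \<iota> DA A S B MB" and K3: "K3 \<iota> A B LA LB"
    and \<rho>: "0 < \<rho>" "norm U \<le> \<rho>" "norm V \<le> \<rho>"
    and P: "\<iota> P = rk_deriv \<iota> A U" and Q: "\<iota> Q = rk_deriv \<iota> A V"
    and SV: "S V \<in> range \<iota>" "normY \<iota> (S V) \<le> K" and SD: "S D \<in> range \<iota>"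
  defines "w \<equiv> S (U - V + D)"
  shows "inner w (S (P - Q)) \<le>
    (\<bar>MA \<rho>\<bar> + \<bar>LA \<rho>\<bar> * \<bar>K\<bar> + \<bar>MB \<rho>\<bar> + \<bar>LB \<rho>\<bar> * \<rho>) * norm w * (norm w + normY \<iota> (S D))"
proof -
  have S: "linear S" and iso: "\<And>y. norm (S y) = norm y" and B: "\<And>y. linear (B y)"
    and MB: "\<And>v. norm (B U v) \<le> MB \<rho> * norm v"
    using K2 \<rho> by (auto simp: K2_def)
  have dom: "\<And>y z. \<iota> z \<in> DA y" and mono: "\<And>x. x \<in> DA U \<Longrightarrow> 0 \<le> inner x (A U x)"
    and MA: "\<And>z. norm (A U (\<iota> z)) \<le> MA \<rho> * norm z"
    using K1 \<rho> unfolding K1_def by blast+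
  obtain v where v: "S V = \<iota> v" "norm v \<le> \<bar>K\<bar>"
    using SV emb(2) by (auto simp: normY_def)
  define q where "q = inv \<iota> (S D)"
  have q: "S D = \<iota> q" "normY \<iota> (S D) = norm q"
    using SD by (auto simp: q_def normY_def f_inv_into_f)
  have "A U (\<iota> U) = \<iota> (- P)" "A V (\<iota> V) = \<iota> (- Q)"
    using P Q by (auto simp: rk_deriv_def linear_neg[OF emb(1)])
  from S_conjugation[OF K2 dom this(1)] S_conjugation[OF K2 dom this(2)]
  have SU: "S U \<in> DA U" and SP: "S P = - (A U (S U) + B U (S U))"
    and SQ: "S Q = - (A V (S V) + B V (S V))"
    by (simp_all only: linear_neg[OF S] minus_equation_iff[of "S _"])
  have w: "w = S U - \<iota> v + \<iota> q"
    by (simp add: w_def linear_add[OF S] linear_diff[OF S] v q)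
  have d1: "S U - \<iota> v \<in> DA U" "A U (S U - \<iota> v) = A U (S U) - A U (\<iota> v)"
    using closed_linear_operator_diff[OF clo SU dom[of v]] by auto
  have d2: "w \<in> DA U" "A U w = A U (S U) - A U (\<iota> v) + A U (\<iota> q)"
    using closed_linear_operator_add[OF clo d1(1) dom[of q]] d1(2) by (auto simp: w)
  define g where "g = A U (\<iota> q) - (A U (\<iota> v) - A V (\<iota> v)) - B U (S (U - V))
    - (B U (S V) - B V (S V))"
  define N where "N = norm w + norm q"
  have N: "0 \<le> N" "norm q \<le> N" by (auto simp: N_def)
  have "norm (U - V) = norm (w - \<iota> q)"
    by (simp add: w v(1)[symmetric] linear_diff[OF S, symmetric] iso)
  also have "\<dots> \<le> norm w + norm (\<iota> q)" by (rule norm_triangle_ineq4)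
  finally have UV: "norm (U - V) \<le> N" using emb(3)[of q] by (simp add: N_def)
  have g1: "norm (A U (\<iota> q)) \<le> \<bar>MA \<rho>\<bar> * N"
    using MA[of q] N by (intro order_trans[OF MA[of q]] mult_mono) auto
  have "norm (A U (\<iota> v) - A V (\<iota> v)) \<le> LA \<rho> * norm (\<iota> (U - V)) * norm v"
    using K3 \<rho> by (auto simp: K3_def)
  also have "\<dots> \<le> \<bar>LA \<rho>\<bar> * N * \<bar>K\<bar>"
    using v N UV emb(3)[of "U - V"] by (intro mult_mono) auto
  finally have g2: "norm (A U (\<iota> v) - A V (\<iota> v)) \<le> \<bar>LA \<rho>\<bar> * N * \<bar>K\<bar>" .
  have g3: "norm (B U (S (U - V))) \<le> \<bar>MB \<rho>\<bar> * N"
    using N UV by (intro order_trans[OF MB] mult_mono) (auto simp: iso)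
  have "norm (B U (S V) - B V (S V)) \<le> LB \<rho> * norm (U - V) * norm (S V)"
    using K3 \<rho> by (auto simp: K3_def)
  also have "\<dots> \<le> \<bar>LB \<rho>\<bar> * N * \<rho>"
    using \<rho> N UV by (intro mult_mono) (auto simp: iso)
  finally have g4: "norm (B U (S V) - B V (S V)) \<le> \<bar>LB \<rho>\<bar> * N * \<rho>" .
  have "norm g \<le> \<bar>MA \<rho>\<bar> * N + \<bar>LA \<rho>\<bar> * N * \<bar>K\<bar> + \<bar>MB \<rho>\<bar> * N + \<bar>LB \<rho>\<bar> * N * \<rho>"
    unfolding g_def
    by (intro order_trans[OF norm_triangle_ineq4] add_mono g1 g2 g3 g4)
  then have g: "norm g \<le> (\<bar>MA \<rho>\<bar> + \<bar>LA \<rho>\<bar> * \<bar>K\<bar> + \<bar>MB \<rho>\<bar> + \<bar>LB \<rho>\<bar> * \<rho>) * N"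
    by (simp add: algebra_simps)
  have "S (P - Q) = g - A U w"
    unfolding d2(2) g_def by (simp add: linear_diff[OF S] linear_diff[OF B] SP SQ v)
  then show ?thesis
    using inner_diff_operator_le[OF mono[OF d2(1)] g] by (simp add: q(2) N_def mult_ac)
qed

section \<open>Stability of the method\<close>

theorem lemma4p3:
  fixes \<iota> :: "'y::{real_inner,complete_space} \<Rightarrow> 'x::{real_inner,complete_space}"
    and DA :: "'y \<Rightarrow> 'x set" and A B :: "'y \<Rightarrow> 'x \<Rightarrow> 'x" and S :: "'y \<Rightarrow> 'x"
    and MA MB LA LB :: "real \<Rightarrow> real"
    and a :: "real^'m^'m" and b :: "real^'m"
    and Cstar R T :: real
  assumes "dense_embedding \<iota>"
    and "\<And>y. closed_linear_operator (DA y) (A y)"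
    and "K1 \<iota> DA A MA" and "K2 \<iota> DA A S B MB" and "K3 \<iota> A B LA LB"
    and "algebraically_stable a b" and "coercive a"
    and "stage_constant a \<iota> A Cstar"
    and "R > 0" and "T > 0"
  shows "\<exists>CX. \<forall>K. \<exists>\<tau>bar>0. \<exists>\<delta>>0. \<exists>CY.
    \<forall>\<tau> (u :: nat \<Rightarrow> 'y) (U :: nat \<Rightarrow> 'm \<Rightarrow> 'y) (us :: nat \<Rightarrow> 'y) (Us :: nat \<Rightarrow> 'm \<Rightarrow> 'y)
      (D :: nat \<Rightarrow> 'm \<Rightarrow> 'y) (d :: nat \<Rightarrow> 'y).
      0 < \<tau> \<longrightarrow> \<tau> \<le> \<tau>bar \<longrightarrow>
      numerical_solution a b \<iota> A Cstar T \<tau> u U \<longrightarrow>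
      perturbed_solution a b \<iota> A T \<tau> us Us D d \<longrightarrow>
      (\<forall>n. real n * \<tau> \<le> T \<longrightarrow> (\<forall>i. S (D n i) \<in> range \<iota>) \<and> S (d (Suc n)) \<in> range \<iota>) \<longrightarrow>
      (\<forall>n. real n * \<tau> \<le> T \<longrightarrow> norm (us n) \<le> R \<and>
         (\<forall>i. norm (Us n i) \<le> R \<and> S (Us n i) \<in> range \<iota> \<and> normY \<iota> (S (Us n i)) \<le> K)) \<longrightarrow>
      (norm (u 0 - us 0))\<^sup>2 + \<tau> * (\<Sum>n | real n * \<tau> \<le> T.
         (\<Sum>i\<in>UNIV. (normY \<iota> (S (D n i)))\<^sup>2) + (norm (d (Suc n) /\<^sub>R \<tau>))\<^sup>2
           + (normY \<iota> (S (d (Suc n))))\<^sup>2) \<le> \<delta>\<^sup>2 \<longrightarrow>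
      (\<forall>n. real n * \<tau> \<le> T \<longrightarrow>
         (norm (u n - us n))\<^sup>2 \<le> CY * ((norm (u 0 - us 0))\<^sup>2 + \<tau> * (\<Sum>k<n.
            (\<Sum>i\<in>UNIV. (normY \<iota> (S (D k i)))\<^sup>2) + (norm (d (Suc k) /\<^sub>R \<tau>))\<^sup>2
              + (normY \<iota> (S (d (Suc k))))\<^sup>2)) \<and>
         (norm (\<iota> (u n - us n)))\<^sup>2 \<le> CX * ((norm (\<iota> (u 0 - us 0)))\<^sup>2 + \<tau> * (\<Sum>k<n.
            (\<Sum>i\<in>UNIV. (norm (D k i))\<^sup>2) + (norm (\<iota> (d (Suc k) /\<^sub>R \<tau>)))\<^sup>2
              + (norm (d (Suc k)))\<^sup>2)))"
proof -
  have lin: "linear \<iota>" and inj: "inj \<iota>" and le: "\<And>y. norm (\<iota> y) \<le> norm y"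
    using assms(1) by (auto simp: dense_embedding_def)
  have S: "linear S" and iso: "\<And>y. norm (S y) = norm y" using assms(4) by (auto simp: K2_def)
  have inv: "invertible a" using assms(7) by (simp add: coercive_def)
  define \<rho> where "\<rho> = R + \<bar>Cstar\<bar> * (R + 1)"
  have "0 \<le> \<bar>Cstar\<bar> * (R + 1)" using \<open>R > 0\<close> by simp
  then have \<rho>: "0 < \<rho>" "R \<le> \<rho>" "\<bar>Cstar\<bar> * (R + 1) \<le> \<rho>" using \<open>R > 0\<close> unfolding \<rho>_def by linarith+
  \<comment> \<open>\<open>\<rho>\<close> bounds the stages of the numerical solution as long as the error in \<open>Y\<close> is at most 1\<close>
  define cX where "cX = \<bar>MA \<rho>\<bar> + \<bar>LA \<rho>\<bar> * \<rho>"
  have cX: "0 \<le> cX" using \<rho> by (simp add: cX_def)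
  obtain \<tau>X C\<^sub>X where \<tau>X: "\<tau>X > 0" and CX: "C\<^sub>X \<ge> 1" and stepX: "\<forall>\<tau> (e::'x) F G p f.
    0 < \<tau> \<longrightarrow> \<tau> \<le> \<tau>X \<longrightarrow> (\<forall>i. F i = e + \<tau> *\<^sub>R (\<Sum>j\<in>UNIV. a $ i $ j *\<^sub>R G j)) \<longrightarrow>
    (\<forall>i. 0 \<le> p i \<and> inner (F i) (G i) \<le> cX * norm (F i) * (norm (F i) + p i)) \<longrightarrow>
    (norm (e + \<tau> *\<^sub>R (\<Sum>i\<in>UNIV. b $ i *\<^sub>R G i) - f))\<^sup>2 \<le>
      (1 + C\<^sub>X * \<tau>) * (norm e)\<^sup>2 + C\<^sub>X * \<tau> * ((\<Sum>i\<in>UNIV. (p i)\<^sup>2) + (norm (f /\<^sub>R \<tau>))\<^sup>2)"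
    by (rule one_step_stability[OF assms(6,7) cX])
  \<comment> \<open>Gronwall's inequality up to time \<open>T\<close>, with one constant in front of all data\<close>
  have growth: "x n \<le> exp (C * T) * C * (x 0 + \<tau> * (\<Sum>k<n. h k))"
    if "C \<ge> 1" "\<tau> > 0" "\<And>k. 0 \<le> h k" "0 \<le> x 0" "real n * \<tau> \<le> T"
      "\<And>k. k < n \<Longrightarrow> x (Suc k) \<le> (1 + C * \<tau>) * x k + C * \<tau> * h k"
    for C \<tau> and x h :: "nat \<Rightarrow> real" and n
  proof -
    have "x n \<le> exp (C * (real n * \<tau>)) * (x 0 + C * \<tau> * (\<Sum>k<n. h k))"
      using that by (intro discrete_gronwall) auto
    also have "\<dots> \<le> exp (C * T) * (C * (x 0 + \<tau> * (\<Sum>k<n. h k)))"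
    proof (intro mult_mono)
      show "exp (C * (real n * \<tau>)) \<le> exp (C * T)" using that by simp
      show "x 0 + C * \<tau> * (\<Sum>k<n. h k) \<le> C * (x 0 + \<tau> * (\<Sum>k<n. h k))"
        using mult_right_mono[OF \<open>C \<ge> 1\<close> \<open>0 \<le> x 0\<close>] by (simp add: algebra_simps)
      show "0 \<le> x 0 + C * \<tau> * (\<Sum>k<n. h k)" using that by (simp add: sum_nonneg)
    qed simp
    finally show ?thesis by (simp only: mult.assoc)
  qed
  show ?thesis
  proof (rule exI[of _ "exp (C\<^sub>X * T) * C\<^sub>X"], intro allI, goal_cases)
    case (1 K)
    define cY where "cY = \<bar>MA \<rho>\<bar> + \<bar>LA \<rho>\<bar> * \<bar>K\<bar> + \<bar>MB \<rho>\<bar> + \<bar>LB \<rho>\<bar> * \<rho>"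
    have cY: "0 \<le> cY" using \<rho> by (simp add: cY_def)
    obtain \<tau>Y C\<^sub>Y where \<tau>Y: "\<tau>Y > 0" and CY: "C\<^sub>Y \<ge> 1" and stepY: "\<forall>\<tau> (e::'x) F G p f.
      0 < \<tau> \<longrightarrow> \<tau> \<le> \<tau>Y \<longrightarrow> (\<forall>i. F i = e + \<tau> *\<^sub>R (\<Sum>j\<in>UNIV. a $ i $ j *\<^sub>R G j)) \<longrightarrow>
      (\<forall>i. 0 \<le> p i \<and> inner (F i) (G i) \<le> cY * norm (F i) * (norm (F i) + p i)) \<longrightarrow>
      (norm (e + \<tau> *\<^sub>R (\<Sum>i\<in>UNIV. b $ i *\<^sub>R G i) - f))\<^sup>2 \<le>
        (1 + C\<^sub>Y * \<tau>) * (norm e)\<^sup>2 + C\<^sub>Y * \<tau> * ((\<Sum>i\<in>UNIV. (p i)\<^sup>2) + (norm (f /\<^sub>R \<tau>))\<^sup>2)"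
      by (rule one_step_stability[OF assms(6,7) cY])
    define E where "E = exp (C\<^sub>Y * T) * C\<^sub>Y"
    have E: "E > 0" using CY by (simp add: E_def)
    \<comment> \<open>with this choice the \<open>Y\<close>-estimate gives \<open>\<parallel>e\<^sub>n\<parallel>\<^sup>2 \<le> E \<delta>\<^sup>2 = 1\<close>\<close>
    define \<delta> where "\<delta> = sqrt (1 / E)"
    have \<delta>: "0 < \<delta>" "\<delta>\<^sup>2 = 1 / E" using E by (simp_all add: \<delta>_def)
    have main: "(norm (u n - us n))\<^sup>2 \<le> E * ((norm (u 0 - us 0))\<^sup>2 + \<tau> * (\<Sum>k<n.
            (\<Sum>i\<in>UNIV. (normY \<iota> (S (D k i)))\<^sup>2) + (norm (d (Suc k) /\<^sub>R \<tau>))\<^sup>2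
              + (normY \<iota> (S (d (Suc k))))\<^sup>2)) \<and>
         (norm (\<iota> (u n - us n)))\<^sup>2 \<le> exp (C\<^sub>X * T) * C\<^sub>X * ((norm (\<iota> (u 0 - us 0)))\<^sup>2 + \<tau> * (\<Sum>k<n.
            (\<Sum>i\<in>UNIV. (norm (D k i))\<^sup>2) + (norm (\<iota> (d (Suc k) /\<^sub>R \<tau>)))\<^sup>2
              + (norm (d (Suc k)))\<^sup>2))"
      if \<tau>: "0 < \<tau>" "\<tau> \<le> min \<tau>X \<tau>Y"
        and num: "numerical_solution a b \<iota> A Cstar T \<tau> u U"
        and pert: "perturbed_solution a b \<iota> A T \<tau> us Us D d"
        and SD: "\<And>n i. real n * \<tau> \<le> T \<Longrightarrow> S (D n i) \<in> range \<iota>"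
        and Us: "\<And>n. real n * \<tau> \<le> T \<Longrightarrow> norm (us n) \<le> R \<and>
         (\<forall>i. norm (Us n i) \<le> R \<and> S (Us n i) \<in> range \<iota> \<and> normY \<iota> (S (Us n i)) \<le> K)"
        and small: "(norm (u 0 - us 0))\<^sup>2 + \<tau> * (\<Sum>n | real n * \<tau> \<le> T.
         (\<Sum>i\<in>UNIV. (normY \<iota> (S (D n i)))\<^sup>2) + (norm (d (Suc n) /\<^sub>R \<tau>))\<^sup>2
           + (normY \<iota> (S (d (Suc n))))\<^sup>2) \<le> \<delta>\<^sup>2"
        and n: "real n * \<tau> \<le> T"
      for \<tau> n and u us d :: "nat \<Rightarrow> 'y" and U Us D :: "nat \<Rightarrow> 'm \<Rightarrow> 'y"
    proof -
      define hY where "hY k = (\<Sum>i\<in>UNIV. (normY \<iota> (S (D k i)))\<^sup>2) + (norm (d (Suc k) /\<^sub>R \<tau>))\<^sup>2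
              + (normY \<iota> (S (d (Suc k))))\<^sup>2" for k
      define hX where "hX k = (\<Sum>i\<in>UNIV. (norm (D k i))\<^sup>2) + (norm (\<iota> (d (Suc k) /\<^sub>R \<tau>)))\<^sup>2
              + (norm (d (Suc k)))\<^sup>2" for k
      have h: "0 \<le> hX k" "0 \<le> hY k" for k by (auto simp: hX_def hY_def sum_nonneg)
      have early: "real k * \<tau> \<le> T" if "k \<le> m" "real m * \<tau> \<le> T" for k m
        using that \<tau> by (meson less_imp_le mult_right_mono of_nat_le_iff order_trans)
      have fin: "finite {n. real n * \<tau> \<le> T}"
      proof (rule finite_subset)
        show "{n. real n * \<tau> \<le> T} \<subseteq> {..nat \<lfloor>T / \<tau>\<rfloor>}"
          using \<tau> by (auto simp: le_nat_floor pos_le_divide_eq)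
      qed simp
      have step: "(norm (u (Suc k) - us (Suc k)))\<^sup>2 \<le>
            (1 + C\<^sub>Y * \<tau>) * (norm (u k - us k))\<^sup>2 + C\<^sub>Y * \<tau> * hY k \<and>
          (norm (\<iota> (u (Suc k) - us (Suc k))))\<^sup>2 \<le>
            (1 + C\<^sub>X * \<tau>) * (norm (\<iota> (u k - us k)))\<^sup>2 + C\<^sub>X * \<tau> * hX k"
        if k: "real k * \<tau> \<le> T" and err: "norm (u k - us k) \<le> 1" for k
      proof -
        have nk: "rk_stages a \<iota> A \<tau> (u k) (U k) (\<lambda>_. 0)"
          "rk_update b \<iota> A \<tau> (u k) (U k) 0 (u (Suc k))"
          and stb: "\<And>i. norm (U k i) \<le> Cstar * norm (u k)"
          using num k by (auto simp: numerical_solution_def stage_bounds_def)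
        have pk: "rk_stages a \<iota> A \<tau> (us k) (Us k) (D k)"
          "rk_update b \<iota> A \<tau> (us k) (Us k) (d (Suc k)) (us (Suc k))"
          using pert k by (auto simp: perturbed_solution_def)
        have "norm (u k) \<le> R + 1"
          using err Us[OF k] norm_triangle_sub[of "u k" "us k"] by linarith
        then have U: "norm (U k i) \<le> \<rho>" for i
          using order_trans[OF stb[of i] mult_mono[of Cstar "\<bar>Cstar\<bar>" "norm (u k)" "R + 1"]] \<rho>(3)
            abs_ge_self[of Cstar]
          by (simp del: abs_ge_self)
        have Us\<rho>: "norm (Us k i) \<le> \<rho>" for i using Us[OF k] \<rho> by (meson order_trans)
        obtain P Q where P: "\<And>i. \<iota> (P i) = rk_deriv \<iota> A (U k i)"
          and Q: "\<And>i. \<iota> (Q i) = rk_deriv \<iota> A (Us k i)"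
          and stage: "\<And>i. U k i - Us k i + D k i =
            (u k - us k) + \<tau> *\<^sub>R (\<Sum>j\<in>UNIV. a $ i $ j *\<^sub>R (P j - Q j))"
          and upd: "u (Suc k) - us (Suc k) =
            (u k - us k) + \<tau> *\<^sub>R (\<Sum>i\<in>UNIV. b $ i *\<^sub>R (P i - Q i)) - d (Suc k)"
          using rk_error_equations[OF lin inj inv _ nk pk] \<tau> by auto
        \<comment> \<open>used with \<open>L = S\<close> and with \<open>L = \<iota>\<close>\<close>
        have transp: "L (U k i - Us k i + D k i) =
            L (u k - us k) + \<tau> *\<^sub>R (\<Sum>j\<in>UNIV. a $ i $ j *\<^sub>R L (P j - Q j))"
          "L (u (Suc k) - us (Suc k)) =
            L (u k - us k) + \<tau> *\<^sub>R (\<Sum>i\<in>UNIV. b $ i *\<^sub>R L (P i - Q i)) - L (d (Suc k))"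
          if L: "linear L" for L :: "'y \<Rightarrow> 'x" and i
          unfolding stage upd
          by (simp_all only: linear_add[OF L] linear_diff[OF L, of _ "d (Suc k)"]
              linear_scale[OF L] linear_sum[OF L])
        have "(norm (S (u k - us k) + \<tau> *\<^sub>R (\<Sum>i\<in>UNIV. b $ i *\<^sub>R S (P i - Q i)) - S (d (Suc k))))\<^sup>2
            \<le> (1 + C\<^sub>Y * \<tau>) * (norm (S (u k - us k)))\<^sup>2 + C\<^sub>Y * \<tau> *
              ((\<Sum>i\<in>UNIV. (normY \<iota> (S (D k i)))\<^sup>2) + (norm (S (d (Suc k)) /\<^sub>R \<tau>))\<^sup>2)"
        proof (rule stepY[rule_format])
          show "0 \<le> normY \<iota> (S (D k i)) \<and> inner (S (U k i - Us k i + D k i)) (S (P i - Q i)) \<le>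
            cY * norm (S (U k i - Us k i + D k i)) *
              (norm (S (U k i - Us k i + D k i)) + normY \<iota> (S (D k i)))" for i
            unfolding cY_def
            using error_dissipation_Y[OF lin inj le assms(2-5) \<rho>(1) U Us\<rho> P Q _ _ SD[OF k]] Us[OF k]
            by (auto simp: normY_def)
        qed (use \<tau> transp(1)[OF S] in auto)
        then have "(norm (u (Suc k) - us (Suc k)))\<^sup>2 \<le> (1 + C\<^sub>Y * \<tau>) * (norm (u k - us k))\<^sup>2 +
            C\<^sub>Y * \<tau> * ((\<Sum>i\<in>UNIV. (normY \<iota> (S (D k i)))\<^sup>2) + (norm (d (Suc k) /\<^sub>R \<tau>))\<^sup>2)"
          unfolding transp(2)[OF S, symmetric] by (simp add: iso)
        also have "\<dots> \<le> (1 + C\<^sub>Y * \<tau>) * (norm (u k - us k))\<^sup>2 + C\<^sub>Y * \<tau> * hY k"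
          using CY \<tau> by (intro add_left_mono mult_left_mono) (auto simp: hY_def)
        finally have 1: "(norm (u (Suc k) - us (Suc k)))\<^sup>2 \<le>
            (1 + C\<^sub>Y * \<tau>) * (norm (u k - us k))\<^sup>2 + C\<^sub>Y * \<tau> * hY k" .
        have "(norm (\<iota> (u k - us k) + \<tau> *\<^sub>R (\<Sum>i\<in>UNIV. b $ i *\<^sub>R \<iota> (P i - Q i)) - \<iota> (d (Suc k))))\<^sup>2
            \<le> (1 + C\<^sub>X * \<tau>) * (norm (\<iota> (u k - us k)))\<^sup>2 + C\<^sub>X * \<tau> *
              ((\<Sum>i\<in>UNIV. (norm (D k i))\<^sup>2) + (norm (\<iota> (d (Suc k)) /\<^sub>R \<tau>))\<^sup>2)"
        proof (rule stepX[rule_format])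
          show "0 \<le> norm (D k i) \<and> inner (\<iota> (U k i - Us k i + D k i)) (\<iota> (P i - Q i)) \<le>
            cX * norm (\<iota> (U k i - Us k i + D k i)) *
              (norm (\<iota> (U k i - Us k i + D k i)) + norm (D k i))" for i
            unfolding cX_def linear_diff[OF lin, of "P i"] P Q
            using error_dissipation_X[OF lin le assms(2,3,5) \<rho>(1) U Us\<rho>] by simp
        qed (use \<tau> transp(1)[OF lin] in auto)
        then have "(norm (\<iota> (u (Suc k) - us (Suc k))))\<^sup>2 \<le>
            (1 + C\<^sub>X * \<tau>) * (norm (\<iota> (u k - us k)))\<^sup>2 +
            C\<^sub>X * \<tau> * ((\<Sum>i\<in>UNIV. (norm (D k i))\<^sup>2) + (norm (\<iota> (d (Suc k) /\<^sub>R \<tau>)))\<^sup>2)"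
          unfolding transp(2)[OF lin, symmetric] linear_scale[OF lin] by simp
        also have "\<dots> \<le> (1 + C\<^sub>X * \<tau>) * (norm (\<iota> (u k - us k)))\<^sup>2 + C\<^sub>X * \<tau> * hX k"
          using CX \<tau> by (intro add_left_mono mult_left_mono) (auto simp: hX_def)
        finally show ?thesis using 1 by blast
      qed
      have small': "(norm (u 0 - us 0))\<^sup>2 + \<tau> * (\<Sum>k<m. hY k) \<le> 1 / E"
        if "real m * \<tau> \<le> T" for m
      proof -
        have "(\<Sum>k<m. hY k) \<le> (\<Sum>n | real n * \<tau> \<le> T. hY n)"
          using early that h by (intro sum_mono2[OF fin]) (auto dest: less_imp_le)
        then have "\<tau> * (\<Sum>k<m. hY k) \<le> \<tau> * (\<Sum>n | real n * \<tau> \<le> T. hY n)"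
          using \<tau> by (intro mult_left_mono) auto
        with small[folded hY_def, unfolded \<delta>(2)] show ?thesis by linarith
      qed
      have err: "norm (u m - us m) \<le> 1" if "real m * \<tau> \<le> T" for m
        using that
      proof (induction m rule: less_induct)
        case (less m)
        have "(norm (u m - us m))\<^sup>2 \<le> E * ((norm (u 0 - us 0))\<^sup>2 + \<tau> * (\<Sum>k<m. hY k))"
          unfolding E_def
        proof (rule growth[where x = "\<lambda>k. (norm (u k - us k))\<^sup>2"])
          fix k assume k: "k < m"
          then have "real k * \<tau> \<le> T" using early[of k m] less.prems by simp
          with less.IH[OF k] step show "(norm (u (Suc k) - us (Suc k)))\<^sup>2 \<le>
            (1 + C\<^sub>Y * \<tau>) * (norm (u k - us k))\<^sup>2 + C\<^sub>Y * \<tau> * hY k" by blast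
        qed (use CY \<tau> h less.prems in auto)
        also have "\<dots> \<le> E * (1 / E)"
          using small'[OF less.prems] E by (intro mult_left_mono) auto
        also have "\<dots> = 1" using E by simp
        finally show ?case by (rule power2_le_imp_le[of _ 1, simplified])
      qed
      have steps: "k < n \<Longrightarrow> (norm (u (Suc k) - us (Suc k)))\<^sup>2 \<le>
            (1 + C\<^sub>Y * \<tau>) * (norm (u k - us k))\<^sup>2 + C\<^sub>Y * \<tau> * hY k \<and>
          (norm (\<iota> (u (Suc k) - us (Suc k))))\<^sup>2 \<le>
            (1 + C\<^sub>X * \<tau>) * (norm (\<iota> (u k - us k)))\<^sup>2 + C\<^sub>X * \<tau> * hX k" for k
        using step err early[of k n] n by simp
      have "(norm (u n - us n))\<^sup>2 \<le> E * ((norm (u 0 - us 0))\<^sup>2 + \<tau> * (\<Sum>k<n. hY k))"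
        unfolding E_def
        by (rule growth[where x = "\<lambda>k. (norm (u k - us k))\<^sup>2"]) (use CY \<tau> h n steps in auto)
      moreover have "(norm (\<iota> (u n - us n)))\<^sup>2 \<le>
          exp (C\<^sub>X * T) * C\<^sub>X * ((norm (\<iota> (u 0 - us 0)))\<^sup>2 + \<tau> * (\<Sum>k<n. hX k))"
        by (rule growth[where x = "\<lambda>k. (norm (\<iota> (u k - us k)))\<^sup>2"]) (use CX \<tau> h n steps in auto)
      ultimately show ?thesis unfolding hX_def hY_def by blast
    qed
    show ?case
    proof (rule exI[of _ "min \<tau>X \<tau>Y"], rule conjI[OF _ exI[of _ \<delta>]], goal_cases)
      case 1
      show ?case using \<tau>X \<tau>Y by simp
    next
      case 2
      show ?case
      proof (rule conjI[OF \<delta>(1) exI[of _ E]], intro allI impI, goal_cases)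
        case (1 \<tau> u U us Us D d n)
        then show ?case by (intro main[OF 1(1-4) _ _ 1(7,8)]) blast+
      qed
    qed
  qed
qed

end
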